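(* Let $k\ge1$, let $n_1,\dots,n_k$ be positive integers, $D=\sum_{i=1}^k n_i$, and for $i\in\{1,\dots,k\}$ let $X_i,Y_i\subset\mathbb Z^{n_i}$ be digital images with the $c_{n_i}$-adjacency. Let $x_i\in X_i$, $y_i\in Y_i$, and let $x_0=(x_1,\dots,x_k)\in\prod_{i=1}^kX_i\subset\mathbb Z^D$ and $y_0=(y_1,\dots,y_k)\in\prod_{i=1}^kY_i\subset\mathbb Z^D$, where the products carry the $c_D$-adjacency. (1) If $X_i\simeq_{c_{n_i},c_{n_i}}Y_i$ for all $i$, then $\prod_{i=1}^kX_i\simeq_{c_D,c_D}\prod_{i=1}^kY_i$. If $(X_i,x_i)\simeq_{c_{n_i},c_{n_i}}(Y_i,y_i)$ for all $i$, then $(\prod_{i=1}^kX_i,x_0)\simeq_{c_D,c_D}(\prod_{i=1}^kY_i,y_0)$. (2) If $X_i\simeq^s_{c_{n_i},c_{n_i}}Y_i$ for all $i$, then $\prod_{i=1}^kX_i\simeq^s_{c_D,c_D}\prod_{i=1}^kY_i$. If $(X_i,x_i)\simeq^s_{c_{n_i},c_{n_i}}(Y_i,y_i)$ for all $i$, then $(\prod_{i=1}^kX_i,x_0)\simeq^s_{c_D,c_D}(\prod_{i=1}^kY_i,y_0)$. (3) If $X_i\simeq^L_{c_{n_i},c_{n_i}}Y_i$ for all $i$, then $\prod_{i=1}^kX_i\simeq^L_{c_D,c_D}\prod_{i=1}^kY_i$. If $(X_i,x_i)\simeq^L_{c_{n_i},c_{n_i}}(Y_i,y_i)$ for all $i$,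 then $(\prod_{i=1}^kX_i,x_0)\simeq^L_{c_D,c_D}(\prod_{i=1}^kY_i,y_0)$. (4) If $X_i\simeq^{\mathbb R}_{c_{n_i},c_{n_i}}Y_i$ for all $i$, then $\prod_{i=1}^kX_i\simeq^{\mathbb R}_{c_D,c_D}\prod_{i=1}^kY_i$. If $(X_i,x_i)\simeq^{\mathbb R}_{c_{n_i},c_{n_i}}(Y_i,y_i)$ for all $i$, then $(\prod_{i=1}^kX_i,x_0)\simeq^{\mathbb R}_{c_D,c_D}(\prod_{i=1}^kY_i,y_0)$.
   Context: A digital image $(X,\kappa)$ is a set $X\subset\mathbb Z^n$ (for some $n\ge 1$) with an adjacency relation $\kappa$ (a symmetric, irreflexive relation). For $1\le u\le n$, distinct points $p,q\in\mathbb Z^n$ are $c_u$-adjacent if there are at most $u$ coordinates $j$ with $|p_j-q_j|=1$ and $p_j=q_j$ for all other coordinates. A subset is $\kappa$-connected if any two distinct points of it are joined by a finite sequence of points of the subset whose consecutive members are $\kappa$-adjacent. A function $f:(X,\kappa)\to(Y,\lambda)$ is $(\kappa,\lambda)$-continuous if it maps $\kappa$-connected sets to $\lambda$-connected sets; equivalently, $\kappa$-adjacent points are mapped to equal or $\lambda$-adjacent points. $\mathbb N=\{1,2,\dots\}$, $[a,b]_{\mathbb Z}=\{z\in\mathbb Z: a\le z\le b\}$; subsets of $\mathbb Z$ carry the adjacency in which consecutive integers are adjacent. Homotopy: continuous $f,g:X\to Y$ are homotopic in $Y$, $f\simeq_{\kappa,\lambda} g$, if there are a positive integer $m$ and $F:X\times[0,m]_{\mathbb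 Z}\to Y$ with $F(x,0)=f(x)$, $F(x,m)=g(x)$ for all $x$, such that $t\mapsto F(x,t)$ is continuous for each $x\in X$ and $x\mapsto F(x,t)$ is $(\kappa,\lambda)$-continuous for each $t$. $F$ holds $x$ fixed if $F(x,t)=F(x,0)$ for all $t$. $X\simeq_{\kappa,\lambda}Y$ (same homotopy type) if there are continuous $f:X\to Y$, $g:Y\to X$ with $g\circ f\simeq1_X$, $f\circ g\simeq1_Y$; $(X,x_0)\simeq_{\kappa,\lambda}(Y,y_0)$ if moreover $f(x_0)=y_0$, $g(y_0)=x_0$ and the homotopies can be chosen to hold $x_0$, respectively $y_0$, fixed. Homotopic similarity: $X\simeq^s_{\kappa,\lambda}Y$ if there are subsets $X_j'\subset X$, $Y_j'\subset Y$ ($j\ge1$) with $X_j'\subset X_{j+1}'$, $Y_j'\subset Y_{j+1}'$, $X=\bigcup_j X_j'$, $Y=\bigcup_j Y_j'$, and continuous $f_j:X_j'\to Y_j'$, $g_j:Y_j'\to X_j'$ such that $g_j\circ f_j\simeq_{\kappa,\kappa}1_{X_j'}$ (in $X_j'$), $f_j\circ g_j\simeq_{\lambda,\lambda}1_{Y_j'}$ (in $Y_j'$), and for $v\le w$, $f_w|_{X_v'}\simeq_{\kappa,\lambda}f_v$ in $Y_v'$ and $g_w|_{Y_v'}\simeq_{\lambda,\kappa}g_v$ in $X_v'$ (in particular $f_w(X_v')\subset Y_v'$, $g_w(Y_v')\subset X_v'$). $(X,x_0)\simeq^s_{\kappa,\lambda}(Y,y_0)$ means in addition $x_0\in X_1'$,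 $y_0\in Y_1'$, $f_j(x_0)=y_0$, $g_j(y_0)=x_0$ for all $j$, and all these homotopies hold the base point in their domain fixed. Long homotopy: a long homotopy from $f$ to $g$ (continuous $X\to Y$), $f\simeq^Lg$, is $F:X\times\mathbb Z\to Y$ such that for each $x\in X$ there is $N_{F,x}\in\mathbb N$ with $F(x,t)=f(x)$ for $t\le -N_{F,x}$ and $F(x,t)=g(x)$ for $t\ge N_{F,x}$; $t\mapsto F(x,t)$ is continuous on $\mathbb Z$ for each $x$; and $x\mapsto F(x,t)$ is $(\kappa,\lambda)$-continuous for each $t\in\mathbb Z$. It holds $x_0$ fixed if $F(x_0,t)$ is the same for all $t\in\mathbb Z$. $X\simeq^L_{\kappa,\lambda}Y$ if there are continuous $f:X\to Y$, $g:Y\to X$ with $g\circ f\simeq^L1_X$, $f\circ g\simeq^L1_Y$; $(X,x_0)\simeq^L_{\kappa,\lambda}(Y,y_0)$ if moreover $f(x_0)=y_0$, $g(y_0)=x_0$ and these long homotopies hold $x_0$, respectively $y_0$, fixed. Real homotopy: $f:[0,1]\to (Y,\lambda)$ ($[0,1]\subset\mathbb R$) is a real $\lambda$-path if (i) there is $\epsilon_0>0$ such that $f$ is constant on $(0,\epsilon_0)$ with value equal or $\lambda$-adjacent to $f(0)$; (ii) there is $\epsilon_1>0$ such that $f$ is constant on $(1-\epsilon_1,1)$ with value equal or $\lambda$-adjacent to $f(1)$; (iii) for each $t\in(0,1)$ there is $\epsilon_t>0$ such that $f$ is constant on each of $(t-\epsilon_t,t)$ and $(t,t+\epsilon_t)$,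 these two values are equal or $\lambda$-adjacent, and at least one of them equals $f(t)$. A real homotopy from $f$ to $g$ (continuous $X\to Y$), $f\simeq^{\mathbb R}g$, is $F:X\times[0,1]\to Y$ with $F(x,0)=f(x)$, $F(x,1)=g(x)$, such that $t\mapsto F(x,t)$ is a real $\lambda$-path in $Y$ for each $x$ and $x\mapsto F(x,t)$ is $(\kappa,\lambda)$-continuous for each $t$. $X\simeq^{\mathbb R}_{\kappa,\lambda}Y$ if there are continuous $f:X\to Y$, $g:Y\to X$ with $g\circ f\simeq^{\mathbb R}1_X$, $f\circ g\simeq^{\mathbb R}1_Y$; $(X,x_0)\simeq^{\mathbb R}_{\kappa,\lambda}(Y,y_0)$ if moreover $f(x_0)=y_0$, $g(y_0)=x_0$ and these real homotopies are constantly $x_0$ at $x_0$, respectively constantly $y_0$ at $y_0$. *)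

theory Defs
  imports "HOL-Analysis.Analysis"
begin

section \<open>Digital images\<close>

text \<open>
  A point of \<open>\<int>\<^sup>n\<close> is an integer list of length \<open>n\<close>; this lets the dimension vary with the
  index of a factor. List positions run over \<open>0, \<dots>, n - 1\<close>.
\<close>

definition int_space :: "nat \<Rightarrow> int list set" where
  "int_space n = {p. length p = n}"

definition digital_image :: "nat \<Rightarrow> int list set \<Rightarrow> (int list \<Rightarrow> int list \<Rightarrow> bool) \<Rightarrow> bool" where
  "digital_image n X \<kappa> \<longleftrightarrow> 1 \<le> n \<and> X \<subseteq> int_space n \<and>
     (\<forall>p\<in>X. \<forall>q\<in>X. \<kappa> p q \<longrightarrow> \<kappa> q p) \<and> (\<forall>p\<in>X. \<not> \<kappa> p p)"

text \<open>\<open>c_adj n u\<close> is the \<open>c\<^sub>u\<close>-adjacency on \<open>\<int>\<^sup>n\<close>, meant for \<open>1 \<le> u \<le> n\<close>.\<close>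

definition c_adj :: "nat \<Rightarrow> nat \<Rightarrow> int list \<Rightarrow> int list \<Rightarrow> bool" where
  "c_adj n u p q \<longleftrightarrow> p \<in> int_space n \<and> q \<in> int_space n \<and> p \<noteq> q \<and>
     card {j. j < n \<and> \<bar>p ! j - q ! j\<bar> = 1} \<le> u \<and>
     (\<forall>j<n. \<bar>p ! j - q ! j\<bar> \<noteq> 1 \<longrightarrow> p ! j = q ! j)"

definition int_adj :: "int \<Rightarrow> int \<Rightarrow> bool" where
  "int_adj s t \<longleftrightarrow> \<bar>s - t\<bar> = 1"

definition adj_or_eq :: "('a \<Rightarrow> 'a \<Rightarrow> bool) \<Rightarrow> 'a \<Rightarrow> 'a \<Rightarrow> bool" where
  "adj_or_eq \<kappa> p q \<longleftrightarrow> p = q \<or> \<kappa> p q"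

definition dig_connected :: "('a \<Rightarrow> 'a \<Rightarrow> bool) \<Rightarrow> 'a set \<Rightarrow> bool" where
  "dig_connected \<kappa> A \<longleftrightarrow> (\<forall>p\<in>A. \<forall>q\<in>A. p \<noteq> q \<longrightarrow>
     (\<exists>ps. ps \<noteq> [] \<and> hd ps = p \<and> last ps = q \<and> set ps \<subseteq> A \<and> successively \<kappa> ps))"

text \<open>
  Maps are total HOL functions, and only their values on the domain \<open>X\<close> matter below. In
  particular the restriction of a map to a subset is the same function with a smaller domain.
\<close>

definition dig_continuous ::
  "('a \<Rightarrow> 'a \<Rightarrow> bool) \<Rightarrow> ('b \<Rightarrow> 'b \<Rightarrow> bool) \<Rightarrow> 'a set \<Rightarrow> 'b set \<Rightarrow> ('a \<Rightarrow> 'b) \<Rightarrow> bool" where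
  "dig_continuous \<kappa> \<mu> X Y f \<longleftrightarrow> f ` X \<subseteq> Y \<and>
     (\<forall>A\<subseteq>X. dig_connected \<kappa> A \<longrightarrow> dig_connected \<mu> (f ` A))"


section \<open>Homotopy\<close>

definition is_homotopy ::
  "('a \<Rightarrow> 'a \<Rightarrow> bool) \<Rightarrow> ('b \<Rightarrow> 'b \<Rightarrow> bool) \<Rightarrow> 'a set \<Rightarrow> 'b set \<Rightarrow>
   ('a \<Rightarrow> 'b) \<Rightarrow> ('a \<Rightarrow> 'b) \<Rightarrow> int \<Rightarrow> ('a \<Rightarrow> int \<Rightarrow> 'b) \<Rightarrow> bool" where
  "is_homotopy \<kappa> \<mu> X Y f g m F \<longleftrightarrow>
     dig_continuous \<kappa> \<mu> X Y f \<and> dig_continuous \<kappa> \<mu> X Y g \<and> 0 < m \<and>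
     (\<forall>x\<in>X. F x 0 = f x \<and> F x m = g x) \<and>
     (\<forall>x\<in>X. dig_continuous int_adj \<mu> {0..m} Y (\<lambda>t. F x t)) \<and>
     (\<forall>t\<in>{0..m}. dig_continuous \<kappa> \<mu> X Y (\<lambda>x. F x t))"

definition homotopic ::
  "('a \<Rightarrow> 'a \<Rightarrow> bool) \<Rightarrow> ('b \<Rightarrow> 'b \<Rightarrow> bool) \<Rightarrow> 'a set \<Rightarrow> 'b set \<Rightarrow>
   ('a \<Rightarrow> 'b) \<Rightarrow> ('a \<Rightarrow> 'b) \<Rightarrow> bool" where
  "homotopic \<kappa> \<mu> X Y f g \<longleftrightarrow> (\<exists>m F. is_homotopy \<kappa> \<mu> X Y f g m F)"

definition homotopic_fixing ::
  "('a \<Rightarrow> 'a \<Rightarrow> bool) \<Rightarrow> ('b \<Rightarrow> 'b \<Rightarrow> bool) \<Rightarrow> 'a set \<Rightarrow> 'b set \<Rightarrow> 'a \<Rightarrow>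
   ('a \<Rightarrow> 'b) \<Rightarrow> ('a \<Rightarrow> 'b) \<Rightarrow> bool" where
  "homotopic_fixing \<kappa> \<mu> X Y x\<^sub>0 f g \<longleftrightarrow>
     (\<exists>m F. is_homotopy \<kappa> \<mu> X Y f g m F \<and> (\<forall>t\<in>{0..m}. F x\<^sub>0 t = F x\<^sub>0 0))"

definition homotopy_equiv ::
  "('a \<Rightarrow> 'a \<Rightarrow> bool) \<Rightarrow> ('b \<Rightarrow> 'b \<Rightarrow> bool) \<Rightarrow> 'a set \<Rightarrow> 'b set \<Rightarrow> bool" where
  "homotopy_equiv \<kappa> \<mu> X Y \<longleftrightarrow> (\<exists>f g.
     dig_continuous \<kappa> \<mu> X Y f \<and> dig_continuous \<mu> \<kappa> Y X g \<and>
     homotopic \<kappa> \<kappa> X X (g \<circ> f) id \<and> homotopic \<mu> \<mu> Y Y (f \<circ> g) id)"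

definition pointed_homotopy_equiv ::
  "('a \<Rightarrow> 'a \<Rightarrow> bool) \<Rightarrow> ('b \<Rightarrow> 'b \<Rightarrow> bool) \<Rightarrow> 'a set \<Rightarrow> 'a \<Rightarrow> 'b set \<Rightarrow> 'b \<Rightarrow> bool" where
  "pointed_homotopy_equiv \<kappa> \<mu> X x\<^sub>0 Y y\<^sub>0 \<longleftrightarrow> (\<exists>f g.
     dig_continuous \<kappa> \<mu> X Y f \<and> dig_continuous \<mu> \<kappa> Y X g \<and>
     f x\<^sub>0 = y\<^sub>0 \<and> g y\<^sub>0 = x\<^sub>0 \<and>
     homotopic_fixing \<kappa> \<kappa> X X x\<^sub>0 (g \<circ> f) id \<and> homotopic_fixing \<mu> \<mu> Y Y y\<^sub>0 (f \<circ> g) id)"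


section \<open>Homotopic similarity\<close>

text \<open>The sequences are indexed by \<open>j \<ge> 1\<close>; values at index \<open>0\<close> are irrelevant.\<close>

definition exhausts :: "(nat \<Rightarrow> 'a set) \<Rightarrow> 'a set \<Rightarrow> bool" where
  "exhausts X' X \<longleftrightarrow>
     (\<forall>j\<ge>1. X' j \<subseteq> X) \<and> (\<forall>j\<ge>1. X' j \<subseteq> X' (Suc j)) \<and> X = (\<Union>j\<in>{1..}. X' j)"

definition homotopically_similar ::
  "('a \<Rightarrow> 'a \<Rightarrow> bool) \<Rightarrow> ('b \<Rightarrow> 'b \<Rightarrow> bool) \<Rightarrow> 'a set \<Rightarrow> 'b set \<Rightarrow> bool" where
  "homotopically_similar \<kappa> \<mu> X Y \<longleftrightarrow> (\<exists>X' Y' f g.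
     exhausts X' X \<and> exhausts Y' Y \<and>
     (\<forall>j\<ge>1. dig_continuous \<kappa> \<mu> (X' j) (Y' j) (f j) \<and> dig_continuous \<mu> \<kappa> (Y' j) (X' j) (g j) \<and>
        homotopic \<kappa> \<kappa> (X' j) (X' j) (g j \<circ> f j) id \<and>
        homotopic \<mu> \<mu> (Y' j) (Y' j) (f j \<circ> g j) id) \<and>
     (\<forall>v\<ge>1. \<forall>w\<ge>v. homotopic \<kappa> \<mu> (X' v) (Y' v) (f w) (f v) \<and>
        homotopic \<mu> \<kappa> (Y' v) (X' v) (g w) (g v)))"

definition pointed_homotopically_similar ::
  "('a \<Rightarrow> 'a \<Rightarrow> bool) \<Rightarrow> ('b \<Rightarrow> 'b \<Rightarrow> bool) \<Rightarrow> 'a set \<Rightarrow> 'a \<Rightarrow> 'b set \<Rightarrow> 'b \<Rightarrow> bool" where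
  "pointed_homotopically_similar \<kappa> \<mu> X x\<^sub>0 Y y\<^sub>0 \<longleftrightarrow> (\<exists>X' Y' f g.
     exhausts X' X \<and> exhausts Y' Y \<and> x\<^sub>0 \<in> X' 1 \<and> y\<^sub>0 \<in> Y' 1 \<and>
     (\<forall>j\<ge>1. dig_continuous \<kappa> \<mu> (X' j) (Y' j) (f j) \<and> dig_continuous \<mu> \<kappa> (Y' j) (X' j) (g j) \<and>
        f j x\<^sub>0 = y\<^sub>0 \<and> g j y\<^sub>0 = x\<^sub>0 \<and>
        homotopic_fixing \<kappa> \<kappa> (X' j) (X' j) x\<^sub>0 (g j \<circ> f j) id \<and>
        homotopic_fixing \<mu> \<mu> (Y' j) (Y' j) y\<^sub>0 (f j \<circ> g j) id) \<and>
     (\<forall>v\<ge>1. \<forall>w\<ge>v. homotopic_fixing \<kappa> \<mu> (X' v) (Y' v) x\<^sub>0 (f w) (f v) \<and>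
        homotopic_fixing \<mu> \<kappa> (Y' v) (X' v) y\<^sub>0 (g w) (g v)))"


section \<open>Long homotopy\<close>

definition is_long_homotopy ::
  "('a \<Rightarrow> 'a \<Rightarrow> bool) \<Rightarrow> ('b \<Rightarrow> 'b \<Rightarrow> bool) \<Rightarrow> 'a set \<Rightarrow> 'b set \<Rightarrow>
   ('a \<Rightarrow> 'b) \<Rightarrow> ('a \<Rightarrow> 'b) \<Rightarrow> ('a \<Rightarrow> int \<Rightarrow> 'b) \<Rightarrow> bool" where
  "is_long_homotopy \<kappa> \<mu> X Y f g F \<longleftrightarrow>
     dig_continuous \<kappa> \<mu> X Y f \<and> dig_continuous \<kappa> \<mu> X Y g \<and>
     (\<forall>x\<in>X. \<exists>N\<ge>1. (\<forall>t\<le>-N. F x t = f x) \<and> (\<forall>t\<ge>N. F x t = g x)) \<and>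
     (\<forall>x\<in>X. dig_continuous int_adj \<mu> UNIV Y (\<lambda>t. F x t)) \<and>
     (\<forall>t. dig_continuous \<kappa> \<mu> X Y (\<lambda>x. F x t))"

definition long_homotopic ::
  "('a \<Rightarrow> 'a \<Rightarrow> bool) \<Rightarrow> ('b \<Rightarrow> 'b \<Rightarrow> bool) \<Rightarrow> 'a set \<Rightarrow> 'b set \<Rightarrow>
   ('a \<Rightarrow> 'b) \<Rightarrow> ('a \<Rightarrow> 'b) \<Rightarrow> bool" where
  "long_homotopic \<kappa> \<mu> X Y f g \<longleftrightarrow> (\<exists>F. is_long_homotopy \<kappa> \<mu> X Y f g F)"

definition long_homotopic_fixing ::
  "('a \<Rightarrow> 'a \<Rightarrow> bool) \<Rightarrow> ('b \<Rightarrow> 'b \<Rightarrow> bool) \<Rightarrow> 'a set \<Rightarrow> 'b set \<Rightarrow> 'a \<Rightarrow>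
   ('a \<Rightarrow> 'b) \<Rightarrow> ('a \<Rightarrow> 'b) \<Rightarrow> bool" where
  "long_homotopic_fixing \<kappa> \<mu> X Y x\<^sub>0 f g \<longleftrightarrow>
     (\<exists>F. is_long_homotopy \<kappa> \<mu> X Y f g F \<and> (\<forall>s t. F x\<^sub>0 s = F x\<^sub>0 t))"

definition long_homotopy_equiv ::
  "('a \<Rightarrow> 'a \<Rightarrow> bool) \<Rightarrow> ('b \<Rightarrow> 'b \<Rightarrow> bool) \<Rightarrow> 'a set \<Rightarrow> 'b set \<Rightarrow> bool" where
  "long_homotopy_equiv \<kappa> \<mu> X Y \<longleftrightarrow> (\<exists>f g.
     dig_continuous \<kappa> \<mu> X Y f \<and> dig_continuous \<mu> \<kappa> Y X g \<and>
     long_homotopic \<kappa> \<kappa> X X (g \<circ> f) id \<and> long_homotopic \<mu> \<mu> Y Y (f \<circ> g) id)"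

definition pointed_long_homotopy_equiv ::
  "('a \<Rightarrow> 'a \<Rightarrow> bool) \<Rightarrow> ('b \<Rightarrow> 'b \<Rightarrow> bool) \<Rightarrow> 'a set \<Rightarrow> 'a \<Rightarrow> 'b set \<Rightarrow> 'b \<Rightarrow> bool" where
  "pointed_long_homotopy_equiv \<kappa> \<mu> X x\<^sub>0 Y y\<^sub>0 \<longleftrightarrow> (\<exists>f g.
     dig_continuous \<kappa> \<mu> X Y f \<and> dig_continuous \<mu> \<kappa> Y X g \<and>
     f x\<^sub>0 = y\<^sub>0 \<and> g y\<^sub>0 = x\<^sub>0 \<and>
     long_homotopic_fixing \<kappa> \<kappa> X X x\<^sub>0 (g \<circ> f) id \<and>
     long_homotopic_fixing \<mu> \<mu> Y Y y\<^sub>0 (f \<circ> g) id)"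


section \<open>Real homotopy\<close>

text \<open>
  The radii \<open>\<epsilon>\<close> may always be shrunk, so it does not matter that they are not required to keep
  the intervals inside \<open>[0, 1]\<close>.
\<close>

definition real_path :: "('b \<Rightarrow> 'b \<Rightarrow> bool) \<Rightarrow> 'b set \<Rightarrow> (real \<Rightarrow> 'b) \<Rightarrow> bool" where
  "real_path \<mu> Y f \<longleftrightarrow> f ` {0..1} \<subseteq> Y \<and>
     (\<exists>\<epsilon>>0. \<exists>c. (\<forall>s\<in>{0<..<\<epsilon>}. f s = c) \<and> adj_or_eq \<mu> c (f 0)) \<and>
     (\<exists>\<epsilon>>0. \<exists>c. (\<forall>s\<in>{1-\<epsilon><..<1}. f s = c) \<and> adj_or_eq \<mu> c (f 1)) \<and>
     (\<forall>t\<in>{0<..<1}. \<exists>\<epsilon>>0. \<exists>a b. (\<forall>s\<in>{t-\<epsilon><..<t}. f s = a) \<and> (\<forall>s\<in>{t<..<t+\<epsilon>}. f s = b) \<and>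
        adj_or_eq \<mu> a b \<and> (f t = a \<or> f t = b))"

definition is_real_homotopy ::
  "('a \<Rightarrow> 'a \<Rightarrow> bool) \<Rightarrow> ('b \<Rightarrow> 'b \<Rightarrow> bool) \<Rightarrow> 'a set \<Rightarrow> 'b set \<Rightarrow>
   ('a \<Rightarrow> 'b) \<Rightarrow> ('a \<Rightarrow> 'b) \<Rightarrow> ('a \<Rightarrow> real \<Rightarrow> 'b) \<Rightarrow> bool" where
  "is_real_homotopy \<kappa> \<mu> X Y f g F \<longleftrightarrow>
     dig_continuous \<kappa> \<mu> X Y f \<and> dig_continuous \<kappa> \<mu> X Y g \<and>
     (\<forall>x\<in>X. F x 0 = f x \<and> F x 1 = g x) \<and>
     (\<forall>x\<in>X. real_path \<mu> Y (\<lambda>t. F x t)) \<and>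
     (\<forall>t\<in>{0..1}. dig_continuous \<kappa> \<mu> X Y (\<lambda>x. F x t))"

definition real_homotopic ::
  "('a \<Rightarrow> 'a \<Rightarrow> bool) \<Rightarrow> ('b \<Rightarrow> 'b \<Rightarrow> bool) \<Rightarrow> 'a set \<Rightarrow> 'b set \<Rightarrow>
   ('a \<Rightarrow> 'b) \<Rightarrow> ('a \<Rightarrow> 'b) \<Rightarrow> bool" where
  "real_homotopic \<kappa> \<mu> X Y f g \<longleftrightarrow> (\<exists>F. is_real_homotopy \<kappa> \<mu> X Y f g F)"

text \<open>Only used for self-maps: the base point stays at itself throughout.\<close>

definition real_homotopic_fixing ::
  "('a \<Rightarrow> 'a \<Rightarrow> bool) \<Rightarrow> 'a set \<Rightarrow> 'a \<Rightarrow> ('a \<Rightarrow> 'a) \<Rightarrow> ('a \<Rightarrow> 'a) \<Rightarrow> bool" where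
  "real_homotopic_fixing \<kappa> X x\<^sub>0 f g \<longleftrightarrow>
     (\<exists>F. is_real_homotopy \<kappa> \<kappa> X X f g F \<and> (\<forall>t\<in>{0..1}. F x\<^sub>0 t = x\<^sub>0))"

definition real_homotopy_equiv ::
  "('a \<Rightarrow> 'a \<Rightarrow> bool) \<Rightarrow> ('b \<Rightarrow> 'b \<Rightarrow> bool) \<Rightarrow> 'a set \<Rightarrow> 'b set \<Rightarrow> bool" where
  "real_homotopy_equiv \<kappa> \<mu> X Y \<longleftrightarrow> (\<exists>f g.
     dig_continuous \<kappa> \<mu> X Y f \<and> dig_continuous \<mu> \<kappa> Y X g \<and>
     real_homotopic \<kappa> \<kappa> X X (g \<circ> f) id \<and> real_homotopic \<mu> \<mu> Y Y (f \<circ> g) id)"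

definition pointed_real_homotopy_equiv ::
  "('a \<Rightarrow> 'a \<Rightarrow> bool) \<Rightarrow> ('b \<Rightarrow> 'b \<Rightarrow> bool) \<Rightarrow> 'a set \<Rightarrow> 'a \<Rightarrow> 'b set \<Rightarrow> 'b \<Rightarrow> bool" where
  "pointed_real_homotopy_equiv \<kappa> \<mu> X x\<^sub>0 Y y\<^sub>0 \<longleftrightarrow> (\<exists>f g.
     dig_continuous \<kappa> \<mu> X Y f \<and> dig_continuous \<mu> \<kappa> Y X g \<and>
     f x\<^sub>0 = y\<^sub>0 \<and> g y\<^sub>0 = x\<^sub>0 \<and>
     real_homotopic_fixing \<kappa> X x\<^sub>0 (g \<circ> f) id \<and> real_homotopic_fixing \<mu> Y y\<^sub>0 (f \<circ> g) id)"


section \<open>Products\<close>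

text \<open>
  The point \<open>(x\<^sub>1, \<dots>, x\<^sub>k)\<close> of \<open>\<int>\<^sup>D\<close>, \<open>D = n\<^sub>1 + \<dots> + n\<^sub>k\<close>, is the concatenation of the
  lists \<open>x\<^sub>1, \<dots>, x\<^sub>k\<close>.
\<close>

definition point_prod :: "nat \<Rightarrow> (nat \<Rightarrow> int list) \<Rightarrow> int list" where
  "point_prod k x = concat (map x [1..<Suc k])"

definition image_prod :: "nat \<Rightarrow> (nat \<Rightarrow> int list set) \<Rightarrow> int list set" where
  "image_prod k X = {point_prod k x | x. \<forall>i\<in>{1..k}. x i \<in> X i}"


section \<open>Basic facts\<close>

lemma digital_image_c_adj:
  assumes "1 \<le> n" "X \<subseteq> int_space n"
  shows "digital_image n X (c_adj n u)"
proof -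
  have "{j. j < n \<and> \<bar>p ! j - q ! j\<bar> = 1} = {j. j < n \<and> \<bar>q ! j - p ! j\<bar> = 1}" for p q :: "int list"
    by (auto simp: abs_minus_commute)
  then show ?thesis
    using assms unfolding digital_image_def c_adj_def by (metis abs_minus_commute)
qed

lemma c_adj_full_iff:
  "c_adj n n p q \<longleftrightarrow> length p = n \<and> length q = n \<and> p \<noteq> q \<and> (\<forall>j<n. \<bar>p ! j - q ! j\<bar> \<le> 1)"
proof -
  have "card {j. j < n \<and> \<bar>p ! j - q ! j\<bar> = 1} \<le> n"
    using card_mono[of "{..<n}" "{j. j < n \<and> \<bar>p ! j - q ! j\<bar> = 1}"] by auto
  moreover have "(\<bar>a - b\<bar> \<noteq> 1 \<longrightarrow> a = b) \<longleftrightarrow> \<bar>a - b\<bar> \<le> 1" for a b :: int by auto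
  ultimately show ?thesis unfolding c_adj_def int_space_def by auto
qed

lemma dig_continuous_iff:
  assumes sym: "\<And>p q. \<kappa> p q \<Longrightarrow> \<kappa> q p" and symm: "\<And>p q. \<mu> p q \<Longrightarrow> \<mu> q p"
  shows "dig_continuous \<kappa> \<mu> X Y f \<longleftrightarrow>
    f ` X \<subseteq> Y \<and> (\<forall>p\<in>X. \<forall>q\<in>X. \<kappa> p q \<longrightarrow> adj_or_eq \<mu> (f p) (f q))"
proof safe
  assume c: "dig_continuous \<kappa> \<mu> X Y f"
  show "f p \<in> Y" if "p \<in> X" for p using c that by (auto simp: dig_continuous_def)
  fix p q assume pq: "p \<in> X" "q \<in> X" "\<kappa> p q"
  have "dig_connected \<kappa> {p, q}" unfolding dig_connected_def
  proof (intro ballI impI)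
    fix a b assume "a \<in> {p, q}" "b \<in> {p, q}" "a \<noteq> b"
    then show "\<exists>ps. ps \<noteq> [] \<and> hd ps = a \<and> last ps = b \<and> set ps \<subseteq> {p, q} \<and> successively \<kappa> ps"
      using pq(3) sym by (intro exI[of _ "[a, b]"]) auto
  qed
  then have con: "dig_connected \<mu> {f p, f q}"
    using c pq unfolding dig_continuous_def by (auto dest!: spec[of _ "{p, q}"])
  show "adj_or_eq \<mu> (f p) (f q)"
  proof (rule ccontr)
    assume n: "\<not> adj_or_eq \<mu> (f p) (f q)"
    then obtain ps where ps: "ps \<noteq> []" "hd ps = f p" "last ps = f q" "set ps \<subseteq> {f p, f q}"
        "successively \<mu> ps"
      using con unfolding dig_connected_def adj_or_eq_def by blast
    have "last qs = f p" if "qs \<noteq> []" "hd qs = f p" "set qs \<subseteq> {f p, f q}" "successively \<mu> qs" for qs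
      using that
    proof (induction qs)
      case (Cons a qs)
      show ?case
      proof (cases qs)
        case (Cons b rs)
        then have "b = f p" using Cons.prems n by (auto simp: adj_or_eq_def)
        then show ?thesis using Cons Cons.prems Cons.IH by auto
      qed (use Cons.prems in auto)
    qed simp
    then show False using ps n by (auto simp: adj_or_eq_def)
  qed
next
  assume Y: "f ` X \<subseteq> Y" and a: "\<forall>p\<in>X. \<forall>q\<in>X. \<kappa> p q \<longrightarrow> adj_or_eq \<mu> (f p) (f q)"
  have walk: "\<exists>qs. qs \<noteq> [] \<and> hd qs = f (hd ps) \<and> last qs = f (last ps) \<and> set qs \<subseteq> f ` set ps \<and>
      successively \<mu> qs" if "ps \<noteq> []" "set ps \<subseteq> X" "successively \<kappa> ps" for ps
    using that
  proof (induction ps)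
    case (Cons p ps)
    show ?case
    proof (cases ps)
      case Nil
      then show ?thesis by (intro exI[of _ "[f p]"]) auto
    next
      case (Cons r rs)
      then obtain qs where qs: "qs \<noteq> []" "hd qs = f r" "last qs = f (last ps)"
          "set qs \<subseteq> f ` set ps" "successively \<mu> qs"
        using Cons.IH Cons.prems by auto
      have "adj_or_eq \<mu> (f p) (f r)" using a Cons Cons.prems by auto
      then consider "f p = f r" | "\<mu> (f p) (f r)" by (auto simp: adj_or_eq_def)
      then show ?thesis
      proof cases
        case 1
        then show ?thesis using qs Cons by (intro exI[of _ qs]) auto
      next
        case 2
        then show ?thesis using qs Cons
          by (intro exI[of _ "f p # qs"]) (auto simp: successively_Cons)
      qed
    qed
  qed simp
  show "dig_continuous \<kappa> \<mu> X Y f" unfolding dig_continuous_def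
  proof (intro conjI Y allI impI)
    fix A assume A: "A \<subseteq> X" "dig_connected \<kappa> A"
    show "dig_connected \<mu> (f ` A)" unfolding dig_connected_def
    proof (intro ballI impI)
      fix y z assume "y \<in> f ` A" "z \<in> f ` A" "y \<noteq> z"
      then obtain p q where pq: "p \<in> A" "q \<in> A" "y = f p" "z = f q" "p \<noteq> q" by auto
      then obtain ps where ps: "ps \<noteq> []" "hd ps = p" "last ps = q" "set ps \<subseteq> A" "successively \<kappa> ps"
        using A(2) unfolding dig_connected_def by blast
      then obtain qs where "qs \<noteq> []" "hd qs = f p" "last qs = f q" "set qs \<subseteq> f ` set ps"
          "successively \<mu> qs"
        using walk[of ps] A(1) by auto
      then show "\<exists>qs. qs \<noteq> [] \<and> hd qs = y \<and> last qs = z \<and> set qs \<subseteq> f ` A \<and> successively \<mu> qs"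
        using ps(4) pq by (intro exI[of _ qs]) auto
    qed
  qed
qed

lemma image_prod_subset:
  assumes "\<And>i. i \<in> {1..k} \<Longrightarrow> X i \<subseteq> int_space (n i)"
  shows "image_prod k X \<subseteq> int_space (\<Sum>i=1..k. n i)"
proof -
  have "length (point_prod k x) = (\<Sum>i=1..k. length (x i))" for x
    by (induction k) (auto simp: point_prod_def)
  moreover have "(\<Sum>i=1..k. length (x i)) = (\<Sum>i=1..k. n i)" if "\<forall>i\<in>{1..k}. x i \<in> X i" for x
    using that assms by (intro sum.cong) (auto simp: int_space_def subset_iff)
  ultimately show ?thesis by (auto simp: image_prod_def int_space_def)
qed

end

theory Submission
  imports Defs
begin

text \<open>
  Since \<open>c\<^sub>D\<close> is the sup-norm adjacency, two points of a product are equal or adjacent iff all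
  their components are, so products of continuous maps are continuous and homotopies can be
  multiplied at each fixed time. Finite homotopies are first prolonged to a common length. For
  real homotopies the componentwise product may fail: if one component jumps just before and
  another just after the same time \<open>t\<close>, the product takes at \<open>t\<close> neither of its one-sided limits.
  This is avoided by first replacing each real homotopy by its left limits at interior times,
  after which every component, hence the product, agrees at \<open>t\<close> with its left limit.
\<close>

section \<open>Points of a product\<close>

text \<open>\<open>c_D\<close> puts no bound on the number of coordinates that change, so all
  factors may move in the same time step; under a smaller bound such moves could add up to too many
  changes. The eight claims collapse along two lines. A set held fixed pointwise stands in for the
  base point, and both the empty set and singletons are stable under products. And the passage from
  homotopies to equivalences never looks inside a homotopy: it uses only that the homotopy relation
  is compatible with products, which is proved once for each of the three notions. Similarity then
  uses the finite notion at every level of the exhaustion. Taking left limits of a real homotopy is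
  delicate in the space variable, since every point has its own radius of constancy and infinitely
  many radii may have infimum 0. It works because continuity is a condition on pairs of adjacent
  points, and two radii have a positive minimum.\<close>

definition block :: "(nat \<Rightarrow> nat) \<Rightarrow> nat \<Rightarrow> int list \<Rightarrow> int list" where
  "block n i p = take (n i) (drop (\<Sum>j=1..<i. n j) p)"

lemma c_adj_full_sym: "c_adj n n p q \<Longrightarrow> c_adj n n q p"
  by (auto simp: c_adj_full_iff abs_minus_commute)

lemma int_adj_sym: "int_adj s t \<Longrightarrow> int_adj t s"
  by (auto simp: int_adj_def)

text \<open>The \<open>list_all2\<close> form is stable under append, take and drop, so adjacency
  passes between a product and its factors without index arithmetic.\<close>

lemma adj_or_eq_c_adj_iff:
  assumes "length p = n" "length q = n"
  shows "adj_or_eq (c_adj n n) p q \<longleftrightarrow> list_all2 (\<lambda>a b. \<bar>a - b\<bar> \<le> 1) p q"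
  using assms by (auto simp: adj_or_eq_def c_adj_full_iff list_all2_conv_all_nth)

lemma point_prod_Suc: "point_prod (Suc k) x = point_prod k x @ x (Suc k)"
  by (simp add: point_prod_def)

lemma length_point_prod: "length (point_prod k x) = (\<Sum>i=1..k. length (x i))"
  by (induction k) (auto simp: point_prod_def)

lemma point_prod_cong:
  "(\<And>i. i \<in> {1..k} \<Longrightarrow> x i = y i) \<Longrightarrow> point_prod k x = point_prod k y"
  unfolding point_prod_def by (intro arg_cong[where f = concat] map_cong) auto

lemma block_point_prod:
  assumes len: "\<forall>j\<in>{1..k}. length (x j) = n j" and i: "i \<in> {1..k}"
  shows "block n i (point_prod k x) = x i"
proof -
  have "[1..<Suc k] = [1..<i] @ [i..<Suc k]"
    using i upt_add_eq_append[of 1 i "Suc k - i"] by auto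
  also have "[i..<Suc k] = i # [Suc i..<Suc k]"
    using i by (auto simp: upt_conv_Cons)
  finally have split: "point_prod k x =
      concat (map x [1..<i]) @ x i @ concat (map x [Suc i..<Suc k])"
    by (simp add: point_prod_def)
  have "length (concat (map x [1..<i])) = (\<Sum>j=1..<i. length (x j))"
    by (simp add: length_concat comp_def interv_sum_list_conv_sum_set_nat)
  also have "\<dots> = (\<Sum>j=1..<i. n j)"
    using i by (intro sum.cong) (auto simp: len)
  finally show ?thesis
    using len[rule_format, OF i] by (simp add: block_def split)
qed

text \<open>Only lengths are assumed, not membership in given images, because the lemma is later
  applied to one-sided limits, whose membership in the factor is not at hand.\<close>

lemma adj_or_eq_point_prod:
  assumes "\<forall>i\<in>{1..k}. length (x i) = n i" "\<forall>i\<in>{1..k}. length (y i) = n i"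
    and "\<forall>i\<in>{1..k}. adj_or_eq (c_adj (n i) (n i)) (x i) (y i)"
  shows "adj_or_eq (c_adj (\<Sum>i=1..k. n i) (\<Sum>i=1..k. n i)) (point_prod k x) (point_prod k y)"
proof -
  have "list_all2 (\<lambda>a b. \<bar>a - b\<bar> \<le> 1) (point_prod k x) (point_prod k y)"
    using assms
  proof (induction k)
    case (Suc k)
    moreover have "list_all2 (\<lambda>a b. \<bar>a - b\<bar> \<le> 1) (x (Suc k)) (y (Suc k))"
      using Suc.prems by (simp add: adj_or_eq_c_adj_iff)
    ultimately show ?case
      by (auto simp: point_prod_Suc intro!: list_all2_appendI)
  qed (simp add: point_prod_def)
  then show ?thesis
    using assms by (subst adj_or_eq_c_adj_iff) (auto simp: length_point_prod)
qed

lemma image_prodI: "(\<forall>i\<in>{1..k}. x i \<in> X i) \<Longrightarrow> point_prod k x \<in> image_prod k X"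
  by (auto simp: image_prod_def)

lemma image_prodE:
  assumes "p \<in> image_prod k X"
  obtains x where "p = point_prod k x" "\<forall>i\<in>{1..k}. x i \<in> X i"
  using assms by (auto simp: image_prod_def)

lemma image_prod_mono:
  "(\<forall>i\<in>{1..k}. X i \<subseteq> Y i) \<Longrightarrow> image_prod k X \<subseteq> image_prod k Y"
  by (force simp: image_prod_def)

text \<open>Here \<open>k >= 1\<close> enters: the empty product would be the single point
  \<open>[]\<close>. With the next lemma this makes the fixed sets of the free and of the pointed
  versions come out right in the product.\<close>

lemma image_prod_empty: "k \<ge> 1 \<Longrightarrow> image_prod k (\<lambda>_. {}) = {}"
  by (auto simp: image_prod_def)

lemma image_prod_singletons: "image_prod k (\<lambda>i. {x i}) = {point_prod k x}"
  by (auto simp: image_prod_def intro: point_prod_cong)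

lemma block_in_factor:
  assumes X: "\<forall>i\<in>{1..k}. X i \<subseteq> int_space (n i)"
    and p: "p \<in> image_prod k X" and i: "i \<in> {1..k}"
  shows "block n i p \<in> X i"
proof -
  obtain x where x: "p = point_prod k x" "\<forall>i\<in>{1..k}. x i \<in> X i"
    using p by (rule image_prodE)
  have "block n i p = x i"
    unfolding x(1) using X x(2) i by (intro block_point_prod) (auto simp: int_space_def)
  then show ?thesis using x(2) i by simp
qed

section \<open>Continuity and products\<close>

lemma dig_continuous_compose:
  "dig_continuous \<kappa> \<mu> X Y f \<Longrightarrow> dig_continuous \<mu> \<nu> Y Z g \<Longrightarrow>
    dig_continuous \<kappa> \<nu> X Z (\<lambda>x. g (f x))"
proof -
  assume fg: "dig_continuous \<kappa> \<mu> X Y f" "dig_continuous \<mu> \<nu> Y Z g"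
  have "dig_connected \<nu> (g ` f ` A)" if "A \<subseteq> X" "dig_connected \<kappa> A" for A
  proof -
    have "f ` A \<subseteq> Y" "dig_connected \<mu> (f ` A)"
      using fg(1) that by (auto simp: dig_continuous_def)
    then show ?thesis using fg(2) by (simp add: dig_continuous_def)
  qed
  then show ?thesis
    using fg unfolding dig_continuous_def image_image[symmetric] by blast
qed

lemma dig_continuous_cong:
  assumes "\<And>x. x \<in> X \<Longrightarrow> f x = g x" "dig_continuous \<kappa> \<mu> X Y f"
  shows "dig_continuous \<kappa> \<mu> X Y g"
proof -
  have "f ` A = g ` A" if "A \<subseteq> X" for A using that assms(1) by (intro image_cong) auto
  then show ?thesis using assms(2) unfolding dig_continuous_def by (metis subset_refl)
qed

text \<open>Projections are continuous because a coordinatewise bound restricts to any segment of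
  coordinates. Adjacent points of the product may share a block, which is where equality is needed
  besides adjacency.\<close>

lemma dig_continuous_block:
  assumes X: "\<forall>i\<in>{1..k}. X i \<subseteq> int_space (n i)" and i: "i \<in> {1..k}"
  shows "dig_continuous (c_adj (\<Sum>i=1..k. n i) (\<Sum>i=1..k. n i)) (c_adj (n i) (n i))
    (image_prod k X) (X i) (block n i)"
proof (subst dig_continuous_iff)
  let ?D = "\<Sum>i=1..k. n i"
  have len: "length p = ?D" if "p \<in> image_prod k X" for p
    using image_prod_subset[of k X n] X that by (auto simp: int_space_def)
  have len': "length (block n i p) = n i" if "p \<in> image_prod k X" for p
    using block_in_factor[OF X that i] X[rule_format, OF i] by (auto simp: int_space_def)
  have "adj_or_eq (c_adj (n i) (n i)) (block n i p) (block n i q)"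
    if "p \<in> image_prod k X" "q \<in> image_prod k X" "c_adj ?D ?D p q" for p q
  proof -
    have "adj_or_eq (c_adj ?D ?D) p q" using that by (simp add: adj_or_eq_def)
    then have "list_all2 (\<lambda>a b. \<bar>a - b\<bar> \<le> 1) p q"
      using len that by (simp add: adj_or_eq_c_adj_iff)
    then show ?thesis
      using len' that by (simp add: adj_or_eq_c_adj_iff)
        (simp add: block_def list_all2_takeI list_all2_dropI)
  qed
  then show "block n i ` image_prod k X \<subseteq> X i \<and> (\<forall>p\<in>image_prod k X. \<forall>q\<in>image_prod k X.
      c_adj ?D ?D p q \<longrightarrow> adj_or_eq (c_adj (n i) (n i)) (block n i p) (block n i q))"
    using block_in_factor[OF X _ i] by blast
qed (auto intro: c_adj_full_sym)

text \<open>The domain and its symmetric adjacency are arbitrary so that the lemma covers both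
  variables of a homotopy: the tracks, with \<open>int_adj\<close> on a set of times, and the
  slices, with \<open>c_D\<close> on the product of the domains.\<close>

lemma dig_continuous_point_prod:
  assumes sym: "\<And>p q. \<kappa> p q \<Longrightarrow> \<kappa> q p"
    and Y: "\<forall>i\<in>{1..k}. Y i \<subseteq> int_space (n i)"
    and f: "\<forall>i\<in>{1..k}. dig_continuous \<kappa> (c_adj (n i) (n i)) T (Y i) (f i)"
  shows "dig_continuous \<kappa> (c_adj (\<Sum>i=1..k. n i) (\<Sum>i=1..k. n i)) T (image_prod k Y)
    (\<lambda>t. point_prod k (\<lambda>i. f i t))"
proof -
  have fi: "f i ` T \<subseteq> Y i \<and> (\<forall>p\<in>T. \<forall>q\<in>T. \<kappa> p q \<longrightarrow> adj_or_eq (c_adj (n i) (n i)) (f i p) (f i q))"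
    if "i \<in> {1..k}" for i
    using f[rule_format, OF that] dig_continuous_iff[of \<kappa> "c_adj (n i) (n i)" T "Y i" "f i"]
      sym c_adj_full_sym by blast
  have len: "length (f i t) = n i" if "i \<in> {1..k}" "t \<in> T" for i t
    using fi[OF that(1)] Y[rule_format, OF that(1)] that(2) by (auto simp: int_space_def)
  show ?thesis
  proof (subst dig_continuous_iff)
    have "point_prod k (\<lambda>i. f i t) \<in> image_prod k Y" if "t \<in> T" for t
      using fi that by (intro image_prodI) blast
    then show "(\<lambda>t. point_prod k (\<lambda>i. f i t)) ` T \<subseteq> image_prod k Y \<and>
        (\<forall>p\<in>T. \<forall>q\<in>T. \<kappa> p q \<longrightarrow> adj_or_eq (c_adj (\<Sum>i=1..k. n i) (\<Sum>i=1..k. n i))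
          (point_prod k (\<lambda>i. f i p)) (point_prod k (\<lambda>i. f i q)))"
      using fi len by (intro conjI ballI impI adj_or_eq_point_prod) auto
  qed (auto intro: sym c_adj_full_sym)
qed

section \<open>Product maps and the functions that represent them\<close>

definition prod_map ::
  "nat \<Rightarrow> (nat \<Rightarrow> nat) \<Rightarrow> (nat \<Rightarrow> int list \<Rightarrow> int list) \<Rightarrow> int list \<Rightarrow> int list" where
  "prod_map k n f p = point_prod k (\<lambda>i. f i (block n i p))"

lemma dig_continuous_prod_map:
  assumes X: "\<forall>i\<in>{1..k}. X i \<subseteq> int_space (n i)"
    and Y: "\<forall>i\<in>{1..k}. Y i \<subseteq> int_space (n i)"
    and f: "\<forall>i\<in>{1..k}.
      dig_continuous (c_adj (n i) (n i)) (c_adj (n i) (n i)) (X i) (Y i) (f i)"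
  shows "dig_continuous (c_adj (\<Sum>i=1..k. n i) (\<Sum>i=1..k. n i)) (c_adj (\<Sum>i=1..k. n i) (\<Sum>i=1..k. n i))
    (image_prod k X) (image_prod k Y) (prod_map k n f)"
  unfolding prod_map_def
proof (rule dig_continuous_point_prod[OF _ Y])
  show "\<forall>i\<in>{1..k}. dig_continuous (c_adj (\<Sum>i=1..k. n i) (\<Sum>i=1..k. n i)) (c_adj (n i) (n i))
      (image_prod k X) (Y i) (\<lambda>p. f i (block n i p))"
    using dig_continuous_compose[OF dig_continuous_block[OF X]] f by blast
qed (rule c_adj_full_sym)

text \<open>
  A relation rather than an equation with \<^const>\<open>prod_map\<close>: maps are total functions, and \<open>id\<close> or
  a composite of product maps equals a \<^const>\<open>prod_map\<close> only on the product set.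
\<close>

definition represents_prod_map ::
  "nat \<Rightarrow> (nat \<Rightarrow> int list set) \<Rightarrow> (nat \<Rightarrow> int list \<Rightarrow> int list) \<Rightarrow> (int list \<Rightarrow> int list) \<Rightarrow> bool" where
  "represents_prod_map k X f \<phi> \<longleftrightarrow>
    (\<forall>x. (\<forall>i\<in>{1..k}. x i \<in> X i) \<longrightarrow> \<phi> (point_prod k x) = point_prod k (\<lambda>i. f i (x i)))"

lemma prod_map_point_prod:
  assumes "\<forall>i\<in>{1..k}. X i \<subseteq> int_space (n i)" "\<forall>i\<in>{1..k}. x i \<in> X i"
  shows "prod_map k n f (point_prod k x) = point_prod k (\<lambda>i. f i (x i))"
proof -
  have "length (x i) = n i" if "i \<in> {1..k}" for i
    using assms that unfolding int_space_def by blast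
  then show ?thesis
    unfolding prod_map_def by (intro point_prod_cong) (simp add: block_point_prod)
qed

lemma represents_prod_map:
  assumes "\<forall>i\<in>{1..k}. X i \<subseteq> int_space (n i)"
  shows "represents_prod_map k X f (prod_map k n f)"
  using prod_map_point_prod[OF assms] by (simp add: represents_prod_map_def)

lemma represents_prod_map_id: "represents_prod_map k X (\<lambda>_. id) id"
  by (simp add: represents_prod_map_def)

lemma represents_prod_map_comp:
  assumes "represents_prod_map k X f \<phi>" "represents_prod_map k Y g \<psi>"
    and "\<forall>i\<in>{1..k}. f i ` X i \<subseteq> Y i"
  shows "represents_prod_map k X (\<lambda>i. g i \<circ> f i) (\<psi> \<circ> \<phi>)"
  unfolding represents_prod_map_def
proof (intro allI impI)
  fix x assume x: "\<forall>i\<in>{1..k}. x i \<in> X i"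
  then have "\<forall>i\<in>{1..k}. f i (x i) \<in> Y i" using assms(3) by blast
  then show "(\<psi> \<circ> \<phi>) (point_prod k x) = point_prod k (\<lambda>i. (g i \<circ> f i) (x i))"
    using assms(1,2) x by (simp add: represents_prod_map_def)
qed

lemma represents_prod_map_image:
  assumes "represents_prod_map k X f \<phi>" "\<forall>i\<in>{1..k}. A i \<subseteq> X i"
    and "\<forall>i\<in>{1..k}. f i ` A i \<subseteq> B i"
  shows "\<phi> ` image_prod k A \<subseteq> image_prod k B"
proof safe
  fix p assume "p \<in> image_prod k A"
  then obtain a where a: "p = point_prod k a" "\<forall>i\<in>{1..k}. a i \<in> A i"
    by (rule image_prodE) blast
  then have "\<phi> p = point_prod k (\<lambda>i. f i (a i))"
    using assms(1,2) unfolding represents_prod_map_def by blast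
  moreover have "\<forall>i\<in>{1..k}. f i (a i) \<in> B i" using a(2) assms(3) by blast
  ultimately show "\<phi> p \<in> image_prod k B" by (simp add: image_prodI)
qed

lemma represents_prod_map_eq:
  assumes X: "\<forall>i\<in>{1..k}. X i \<subseteq> int_space (n i)"
    and "represents_prod_map k X f \<phi>" "p \<in> image_prod k X"
  shows "\<phi> p = prod_map k n f p"
proof -
  obtain x where "p = point_prod k x" "\<forall>i\<in>{1..k}. x i \<in> X i"
    using assms(3) by (rule image_prodE) blast
  then show ?thesis
    using assms(2) prod_map_point_prod[OF X] by (simp add: represents_prod_map_def)
qed

lemma dig_continuous_represents:
  assumes X: "\<forall>i\<in>{1..k}. X i \<subseteq> int_space (n i)"
    and Y: "\<forall>i\<in>{1..k}. Y i \<subseteq> int_space (n i)"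
    and f: "\<forall>i\<in>{1..k}.
      dig_continuous (c_adj (n i) (n i)) (c_adj (n i) (n i)) (X i) (Y i) (f i)"
    and \<phi>: "represents_prod_map k X f \<phi>"
  shows "dig_continuous (c_adj (\<Sum>i=1..k. n i) (\<Sum>i=1..k. n i)) (c_adj (\<Sum>i=1..k. n i) (\<Sum>i=1..k. n i))
    (image_prod k X) (image_prod k Y) \<phi>"
  using dig_continuous_cong[OF _ dig_continuous_prod_map[OF X Y f], of \<phi>]
    represents_prod_map_eq[OF X \<phi>] by simp

section \<open>Homotopies relative to a set\<close>

text \<open>Taking \<open>A = {}\<close> gives the free notions and \<open>A = {x\<^sub>0}\<close> the pointed ones.\<close>

definition homotopic_rel where
  "homotopic_rel \<kappa> \<mu> X Y A f g \<longleftrightarrow>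
    (\<exists>m F. is_homotopy \<kappa> \<mu> X Y f g m F \<and> (\<forall>a\<in>A. \<forall>t\<in>{0..m}. F a t = F a 0))"

definition long_homotopic_rel where
  "long_homotopic_rel \<kappa> \<mu> X Y A f g \<longleftrightarrow>
    (\<exists>F. is_long_homotopy \<kappa> \<mu> X Y f g F \<and> (\<forall>a\<in>A. \<forall>s t. F a s = F a t))"

definition real_homotopic_rel where
  "real_homotopic_rel \<kappa> \<mu> X Y A f g \<longleftrightarrow>
    (\<exists>F. is_real_homotopy \<kappa> \<mu> X Y f g F \<and> (\<forall>a\<in>A. \<forall>t\<in>{0..1}. F a t = F a 0))"

section \<open>Homotopy relations compatible with products, and the equivalences they define\<close>

type_synonym homotopy_relation =
  "(int list \<Rightarrow> int list \<Rightarrow> bool) \<Rightarrow> (int list \<Rightarrow> int list \<Rightarrow> bool) \<Rightarrow> int list set \<Rightarrow> int list set \<Rightarrow>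
    int list set \<Rightarrow> (int list \<Rightarrow> int list) \<Rightarrow> (int list \<Rightarrow> int list) \<Rightarrow> bool"

text \<open>Points of all dimensions share the type \<open>int list\<close>, so a single
  \<open>H\<close> can be evaluated on every factor and on the product. Arbitrary representatives
  \<phi> and \<psi> allow composites and \<open>id\<close> to be inserted directly. Domain and
  codomain may differ because similarity also compares maps from \<open>X' v\<close> to
  \<open>Y' v\<close>.\<close>

definition multiplicative :: "nat \<Rightarrow> (nat \<Rightarrow> nat) \<Rightarrow> homotopy_relation \<Rightarrow> bool" where
  "multiplicative k n H \<longleftrightarrow> (\<forall>X Y A f g \<phi> \<psi>.
    (\<forall>i\<in>{1..k}. X i \<subseteq> int_space (n i) \<and> Y i \<subseteq> int_space (n i) \<and> A i \<subseteq> X i \<and>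
      H (c_adj (n i) (n i)) (c_adj (n i) (n i)) (X i) (Y i) (A i) (f i) (g i)) \<longrightarrow>
    represents_prod_map k X f \<phi> \<longrightarrow> represents_prod_map k X g \<psi> \<longrightarrow>
    H (c_adj (\<Sum>i=1..k. n i) (\<Sum>i=1..k. n i)) (c_adj (\<Sum>i=1..k. n i) (\<Sum>i=1..k. n i))
      (image_prod k X) (image_prod k Y) (image_prod k A) \<phi> \<psi>)"

text \<open>The inclusions for \<open>A\<close> and \<open>B\<close> encode the base point
  conditions: for singletons they say \<open>f x = y\<close> and \<open>g y = x\<close>, for empty
  sets they say nothing.\<close>

definition equiv_rel where
  "equiv_rel H \<kappa> \<mu> X A Y B \<longleftrightarrow> (\<exists>f g.
    dig_continuous \<kappa> \<mu> X Y f \<and> dig_continuous \<mu> \<kappa> Y X g \<and> f ` A \<subseteq> B \<and> g ` B \<subseteq> A \<and>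
    H \<kappa> \<kappa> X X A (g \<circ> f) id \<and> H \<mu> \<mu> Y Y B (f \<circ> g) id)"

lemma equiv_rel_image_prod:
  assumes H: "multiplicative k n H"
    and X: "\<forall>i\<in>{1..k}. X i \<subseteq> int_space (n i)"
    and Y: "\<forall>i\<in>{1..k}. Y i \<subseteq> int_space (n i)"
    and A: "\<forall>i\<in>{1..k}. A i \<subseteq> X i" and B: "\<forall>i\<in>{1..k}. B i \<subseteq> Y i"
    and e: "\<forall>i\<in>{1..k}. equiv_rel H (c_adj (n i) (n i)) (c_adj (n i) (n i)) (X i) (A i) (Y i) (B i)"
  shows "equiv_rel H (c_adj (\<Sum>i=1..k. n i) (\<Sum>i=1..k. n i)) (c_adj (\<Sum>i=1..k. n i) (\<Sum>i=1..k. n i))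
    (image_prod k X) (image_prod k A) (image_prod k Y) (image_prod k B)"
proof -
  from e[unfolded equiv_rel_def bchoice_iff] obtain f g where fg: "\<forall>i\<in>{1..k}.
    dig_continuous (c_adj (n i) (n i)) (c_adj (n i) (n i)) (X i) (Y i) (f i) \<and>
    dig_continuous (c_adj (n i) (n i)) (c_adj (n i) (n i)) (Y i) (X i) (g i) \<and>
    f i ` A i \<subseteq> B i \<and> g i ` B i \<subseteq> A i \<and>
    H (c_adj (n i) (n i)) (c_adj (n i) (n i)) (X i) (X i) (A i) (g i \<circ> f i) id \<and>
    H (c_adj (n i) (n i)) (c_adj (n i) (n i)) (Y i) (Y i) (B i) (f i \<circ> g i) id"
    by blast
  let ?D = "\<Sum>i=1..k. n i" and ?f = "prod_map k n f" and ?g = "prod_map k n g"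
  note mult = H[unfolded multiplicative_def, THEN spec, THEN spec, THEN spec, THEN spec, THEN spec,
      THEN spec, THEN spec, THEN mp, THEN mp, THEN mp]
  have rf: "represents_prod_map k X f ?f" and rg: "represents_prod_map k Y g ?g"
    using represents_prod_map X Y by blast+
  have im: "f i ` X i \<subseteq> Y i" "g i ` Y i \<subseteq> X i" if "i \<in> {1..k}" for i
    using fg[rule_format, OF that] by (simp_all add: dig_continuous_def)
  have 1: "represents_prod_map k X (\<lambda>i. g i \<circ> f i) (?g \<circ> ?f)"
    by (rule represents_prod_map_comp[OF rf rg]) (use im in blast)
  have 2: "represents_prod_map k Y (\<lambda>i. f i \<circ> g i) (?f \<circ> ?g)"
    by (rule represents_prod_map_comp[OF rg rf]) (use im in blast)
  show ?thesis
    unfolding equiv_rel_def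
  proof (intro exI conjI)
    show "dig_continuous (c_adj ?D ?D) (c_adj ?D ?D) (image_prod k X) (image_prod k Y) ?f"
      by (rule dig_continuous_prod_map[OF X Y]) (use fg in blast)
    show "dig_continuous (c_adj ?D ?D) (c_adj ?D ?D) (image_prod k Y) (image_prod k X) ?g"
      by (rule dig_continuous_prod_map[OF Y X]) (use fg in blast)
    show "?f ` image_prod k A \<subseteq> image_prod k B"
      by (rule represents_prod_map_image[OF rf A]) (use fg in blast)
    show "?g ` image_prod k B \<subseteq> image_prod k A"
      by (rule represents_prod_map_image[OF rg B]) (use fg in blast)
    show "H (c_adj ?D ?D) (c_adj ?D ?D) (image_prod k X) (image_prod k X) (image_prod k A)
        (?g \<circ> ?f) id"
      by (rule mult[OF _ 1 represents_prod_map_id]) (use fg X A in blast)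
    show "H (c_adj ?D ?D) (c_adj ?D ?D) (image_prod k Y) (image_prod k Y) (image_prod k B)
        (?f \<circ> ?g) id"
      by (rule mult[OF _ 2 represents_prod_map_id]) (use fg Y B in blast)
  qed
qed

subsection \<open>Finite homotopies\<close>

text \<open>After time \<open>m\<close> the prolonged homotopy waits at \<open>g\<close>. Clamping
  time at \<open>m\<close> is a continuous map of integer intervals, so the tracks stay continuous,
  and every new slice is one of the old slices.\<close>

lemma is_homotopy_extend:
  assumes F: "is_homotopy \<kappa> \<mu> X Y f g m F" and M: "m \<le> M"
  shows "is_homotopy \<kappa> \<mu> X Y f g M (\<lambda>x t. F x (min t m))"
proof -
  have m: "0 < m" using F by (simp add: is_homotopy_def)
  have "dig_continuous int_adj int_adj {0..M} {0..m} (\<lambda>t. min t m)"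
    using m by (subst dig_continuous_iff) (auto simp: int_adj_def adj_or_eq_def)
  then have "dig_continuous int_adj \<mu> {0..M} Y (\<lambda>t. F x (min t m))" if "x \<in> X" for x
    using dig_continuous_compose[of int_adj int_adj "{0..M}" "{0..m}" "\<lambda>t. min t m" \<mu> Y "F x"]
      F that unfolding is_homotopy_def by blast
  moreover have "min t m \<in> {0..m}" if "t \<in> {0..M}" for t using that m by auto
  ultimately show ?thesis
    using F M m unfolding is_homotopy_def by (simp add: min_absorb1 min_absorb2)
qed

lemma multiplicative_homotopic_rel: "multiplicative k n homotopic_rel"
  unfolding multiplicative_def
proof (intro allI impI)
  fix X Y A f g \<phi> \<psi>
  let ?c = "\<lambda>i. c_adj (n i) (n i)"
  assume h: "\<forall>i\<in>{1..k}. X i \<subseteq> int_space (n i) \<and> Y i \<subseteq> int_space (n i) \<and> A i \<subseteq> X i \<and>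
      homotopic_rel (?c i) (?c i) (X i) (Y i) (A i) (f i) (g i)"
    and \<phi>: "represents_prod_map k X f \<phi>" and \<psi>: "represents_prod_map k X g \<psi>"
  then have X: "\<forall>i\<in>{1..k}. X i \<subseteq> int_space (n i)"
    and Y: "\<forall>i\<in>{1..k}. Y i \<subseteq> int_space (n i)"
    and A_space: "\<forall>i\<in>{1..k}. A i \<subseteq> int_space (n i)" by blast+
  have "\<forall>i\<in>{1..k}. \<exists>m F. is_homotopy (?c i) (?c i) (X i) (Y i) (f i) (g i) m F \<and>
      (\<forall>a\<in>A i. \<forall>t\<in>{0..m}. F a t = F a 0)"
    using h by (simp add: homotopic_rel_def)
  from this[unfolded bchoice_iff] obtain m G where
    G: "\<forall>i\<in>{1..k}. is_homotopy (?c i) (?c i) (X i) (Y i) (f i) (g i) (m i) (G i)"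
    and GA: "\<And>i a t. i \<in> {1..k} \<Longrightarrow> a \<in> A i \<Longrightarrow> t \<in> {0..m i} \<Longrightarrow> G i a t = G i a 0"
    by blast
  \<comment> \<open>Inserting 1 keeps the set nonempty for every \<open>k\<close> and gives the
    positive duration that a homotopy must have.\<close>
  define M where "M = Max (insert 1 (m ` {1..k}))"
  define F where "F i a t = G i a (min t (m i))" for i a t
  have "m i \<le> M" if "i \<in> {1..k}" for i
    unfolding M_def using that by (intro Max_ge) auto
  then have F: "is_homotopy (?c i) (?c i) (X i) (Y i) (f i) (g i) M (F i)" if "i \<in> {1..k}" for i
    unfolding F_def using is_homotopy_extend[OF G[rule_format]] that by blast
  have "0 < m i" if "i \<in> {1..k}" for i using G[rule_format, OF that] by (simp add: is_homotopy_def)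
  then have FA: "F i a t = F i a 0" if "i \<in> {1..k}" "a \<in> A i" "t \<in> {0..M}" for i a t
    unfolding F_def using GA[OF that(1,2), of "min t (m i)"] that by (simp add: order_less_imp_le)
  let ?D = "\<Sum>i=1..k. n i" and ?F = "\<lambda>p t. prod_map k n (\<lambda>i a. F i a t) p"
  have blk: "block n i p \<in> X i" if "i \<in> {1..k}" "p \<in> image_prod k X" for i p
    using block_in_factor[OF X] that by blast
  have "is_homotopy (c_adj ?D ?D) (c_adj ?D ?D) (image_prod k X) (image_prod k Y) \<phi> \<psi> M ?F"
    unfolding is_homotopy_def
  proof (intro conjI ballI)
    show "dig_continuous (c_adj ?D ?D) (c_adj ?D ?D) (image_prod k X) (image_prod k Y) \<phi>"
      by (rule dig_continuous_represents[OF X Y _ \<phi>]) (use F in \<open>auto simp: is_homotopy_def\<close>)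
    show "dig_continuous (c_adj ?D ?D) (c_adj ?D ?D) (image_prod k X) (image_prod k Y) \<psi>"
      by (rule dig_continuous_represents[OF X Y _ \<psi>]) (use F in \<open>auto simp: is_homotopy_def\<close>)
    have "1 \<le> M" by (auto simp: M_def intro!: Max_ge)
    then show "0 < M" by simp
    fix p assume p: "p \<in> image_prod k X"
    have ends: "F i (block n i p) 0 = f i (block n i p)" "F i (block n i p) M = g i (block n i p)"
      if "i \<in> {1..k}" for i
      using F[OF that] blk[OF that p] by (auto simp: is_homotopy_def)
    show "?F p 0 = \<phi> p" "?F p M = \<psi> p"
      unfolding represents_prod_map_eq[OF X \<phi> p] represents_prod_map_eq[OF X \<psi> p] prod_map_def
      by (intro point_prod_cong ends; assumption)+
    show "dig_continuous int_adj (c_adj ?D ?D) {0..M} (image_prod k Y) (?F p)"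
      unfolding prod_map_def
      by (rule dig_continuous_point_prod[OF int_adj_sym Y])
        (use F blk p in \<open>auto simp: is_homotopy_def\<close>)
  next
    fix t assume "t \<in> {0..M}"
    then show "dig_continuous (c_adj ?D ?D) (c_adj ?D ?D) (image_prod k X) (image_prod k Y)
        (\<lambda>p. ?F p t)"
      using F by (intro dig_continuous_prod_map X Y) (auto simp: is_homotopy_def)
  qed
  moreover have "?F p t = ?F p 0" if "p \<in> image_prod k A" "t \<in> {0..M}" for p t
  proof -
    have blkA: "block n i p \<in> A i" if "i \<in> {1..k}" for i
      using block_in_factor[OF A_space \<open>p \<in> _\<close> that] .
    have "F i (block n i p) t = F i (block n i p) 0" if "i \<in> {1..k}" for i
      by (rule FA[OF that _ \<open>t \<in> _\<close>]) (rule blkA[OF that])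
    then show ?thesis
      unfolding prod_map_def by (rule point_prod_cong)
  qed
  ultimately show "homotopic_rel (c_adj ?D ?D) (c_adj ?D ?D) (image_prod k X) (image_prod k Y)
      (image_prod k A) \<phi> \<psi>"
    unfolding homotopic_rel_def by blast
qed

subsection \<open>Long homotopies\<close>

lemma multiplicative_long_homotopic_rel: "multiplicative k n long_homotopic_rel"
  unfolding multiplicative_def
proof (intro allI impI)
  fix X Y A f g \<phi> \<psi>
  let ?c = "\<lambda>i. c_adj (n i) (n i)"
  assume h: "\<forall>i\<in>{1..k}. X i \<subseteq> int_space (n i) \<and> Y i \<subseteq> int_space (n i) \<and> A i \<subseteq> X i \<and>
      long_homotopic_rel (?c i) (?c i) (X i) (Y i) (A i) (f i) (g i)"
    and \<phi>: "represents_prod_map k X f \<phi>" and \<psi>: "represents_prod_map k X g \<psi>"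
  then have X: "\<forall>i\<in>{1..k}. X i \<subseteq> int_space (n i)"
    and Y: "\<forall>i\<in>{1..k}. Y i \<subseteq> int_space (n i)"
    and A_space: "\<forall>i\<in>{1..k}. A i \<subseteq> int_space (n i)" by blast+
  have "\<forall>i\<in>{1..k}. \<exists>F. is_long_homotopy (?c i) (?c i) (X i) (Y i) (f i) (g i) F \<and>
      (\<forall>a\<in>A i. \<forall>s t. F a s = F a t)"
    using h by (simp add: long_homotopic_rel_def)
  from this[unfolded bchoice_iff] obtain F where
    F: "\<forall>i\<in>{1..k}. is_long_homotopy (?c i) (?c i) (X i) (Y i) (f i) (g i) (F i)"
    and FA: "\<And>i a s t. i \<in> {1..k} \<Longrightarrow> a \<in> A i \<Longrightarrow> F i a s = F i a t"
    by blast
  let ?D = "\<Sum>i=1..k. n i" and ?F = "\<lambda>p t. prod_map k n (\<lambda>i a. F i a t) p"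
  have blk: "block n i p \<in> X i" if "i \<in> {1..k}" "p \<in> image_prod k X" for i p
    using block_in_factor[OF X] that by blast
  have "is_long_homotopy (c_adj ?D ?D) (c_adj ?D ?D) (image_prod k X) (image_prod k Y) \<phi> \<psi> ?F"
    unfolding is_long_homotopy_def
  proof (intro conjI ballI allI)
    show "dig_continuous (c_adj ?D ?D) (c_adj ?D ?D) (image_prod k X) (image_prod k Y) \<phi>"
      by (rule dig_continuous_represents[OF X Y _ \<phi>]) (use F in \<open>auto simp: is_long_homotopy_def\<close>)
    show "dig_continuous (c_adj ?D ?D) (c_adj ?D ?D) (image_prod k X) (image_prod k Y) \<psi>"
      by (rule dig_continuous_represents[OF X Y _ \<psi>]) (use F in \<open>auto simp: is_long_homotopy_def\<close>)
    fix p assume p: "p \<in> image_prod k X"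
    have "\<forall>i\<in>{1..k}. \<exists>N::int. (\<forall>t\<le>-N. F i (block n i p) t = f i (block n i p)) \<and>
        (\<forall>t\<ge>N. F i (block n i p) t = g i (block n i p))"
      using F blk p unfolding is_long_homotopy_def by blast
    from this[unfolded bchoice_iff] obtain N :: "nat \<Rightarrow> int" where
      N: "\<And>i t. i \<in> {1..k} \<Longrightarrow> t \<le> - N i \<Longrightarrow> F i (block n i p) t = f i (block n i p)"
        "\<And>i t. i \<in> {1..k} \<Longrightarrow> t \<ge> N i \<Longrightarrow> F i (block n i p) t = g i (block n i p)"
      by blast
    \<comment> \<open>The bound depends on the fixed point \<open>p\<close>: a long homotopy has no
      uniform stopping time, but \<open>p\<close> has only finitely many components. Inserting 1
      restores the condition \<open>N >= 1\<close> that was dropped when the \<open>N i\<close> were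
      chosen.\<close>
    define M where "M = Max (insert 1 (N ` {1..k}))"
    have M: "N i \<le> M" if "i \<in> {1..k}" for i
    unfolding M_def using that by (intro Max_ge) auto
    have "1 \<le> M" by (auto simp: M_def intro!: Max_ge)
    moreover have "?F p t = \<phi> p" if "t \<le> - M" for t
      unfolding represents_prod_map_eq[OF X \<phi> p] prod_map_def
      using M that by (intro point_prod_cong N(1)) force+
    moreover have "?F p t = \<psi> p" if "t \<ge> M" for t
      unfolding represents_prod_map_eq[OF X \<psi> p] prod_map_def
      using M that by (intro point_prod_cong N(2)) force+
    ultimately show "\<exists>N\<ge>1. (\<forall>t\<le>-N. ?F p t = \<phi> p) \<and> (\<forall>t\<ge>N. ?F p t = \<psi> p)" by blast
    show "dig_continuous int_adj (c_adj ?D ?D) UNIV (image_prod k Y) (?F p)"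
      unfolding prod_map_def
      by (rule dig_continuous_point_prod[OF int_adj_sym Y])
        (use F blk p in \<open>auto simp: is_long_homotopy_def\<close>)
  next
    fix t
    show "dig_continuous (c_adj ?D ?D) (c_adj ?D ?D) (image_prod k X) (image_prod k Y)
        (\<lambda>p. ?F p t)"
      using F by (intro dig_continuous_prod_map X Y) (auto simp: is_long_homotopy_def)
  qed
  moreover have "?F p s = ?F p t" if "p \<in> image_prod k A" for p s t
  proof -
    have blkA: "block n i p \<in> A i" if "i \<in> {1..k}" for i
      using block_in_factor[OF A_space \<open>p \<in> _\<close> that] .
    have "F i (block n i p) s = F i (block n i p) t" if "i \<in> {1..k}" for i
      by (rule FA[OF that]) (rule blkA[OF that])
    then show ?thesis
      unfolding prod_map_def by (rule point_prod_cong)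
  qed
  ultimately show "long_homotopic_rel (c_adj ?D ?D) (c_adj ?D ?D) (image_prod k X) (image_prod k Y)
      (image_prod k A) \<phi> \<psi>"
    unfolding long_homotopic_rel_def by blast
qed

subsection \<open>Real homotopies\<close>

text \<open>In filter form, finitely many radii are combined by closure of eventuality under finite
  conjunctions, with no explicit minima in the product argument.\<close>

lemma real_path_iff_eventually:
  "real_path \<mu> Y f \<longleftrightarrow> f ` {0..1} \<subseteq> Y \<and>
    (\<exists>c. (\<forall>\<^sub>F s in at_right 0. f s = c) \<and> adj_or_eq \<mu> c (f 0)) \<and>
    (\<exists>c. (\<forall>\<^sub>F s in at_left 1. f s = c) \<and> adj_or_eq \<mu> c (f 1)) \<and>
    (\<forall>t\<in>{0<..<1}. \<exists>a b. (\<forall>\<^sub>F s in at_left t. f s = a) \<and> (\<forall>\<^sub>F s in at_right t. f s = b) \<and>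
      adj_or_eq \<mu> a b \<and> (f t = a \<or> f t = b))"
proof -
  have R: "(\<forall>\<^sub>F s in at_right t. f s = c) \<longleftrightarrow> (\<exists>\<epsilon>>0. \<forall>s\<in>{t<..<t+\<epsilon>}. f s = c)" for t c
  proof
    assume "\<forall>\<^sub>F s in at_right t. f s = c"
    then obtain u where "u > t" "\<And>s. t < s \<Longrightarrow> s < u \<Longrightarrow> f s = c"
      unfolding eventually_at_right_field by blast
    then show "\<exists>\<epsilon>>0. \<forall>s\<in>{t<..<t+\<epsilon>}. f s = c" by (intro exI[of _ "u - t"]) auto
  next
    assume "\<exists>\<epsilon>>0. \<forall>s\<in>{t<..<t+\<epsilon>}. f s = c"
    then obtain \<epsilon> where "\<epsilon> > 0" "\<forall>s\<in>{t<..<t+\<epsilon>}. f s = c" by blast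
    then show "\<forall>\<^sub>F s in at_right t. f s = c"
      unfolding eventually_at_right_field by (intro exI[of _ "t + \<epsilon>"]) auto
  qed
  have L: "(\<forall>\<^sub>F s in at_left t. f s = c) \<longleftrightarrow> (\<exists>\<epsilon>>0. \<forall>s\<in>{t-\<epsilon><..<t}. f s = c)" for t c
  proof
    assume "\<forall>\<^sub>F s in at_left t. f s = c"
    then obtain u where "u < t" "\<And>s. u < s \<Longrightarrow> s < t \<Longrightarrow> f s = c"
      unfolding eventually_at_left_field by blast
    then show "\<exists>\<epsilon>>0. \<forall>s\<in>{t-\<epsilon><..<t}. f s = c" by (intro exI[of _ "t - u"]) auto
  next
    assume "\<exists>\<epsilon>>0. \<forall>s\<in>{t-\<epsilon><..<t}. f s = c"
    then obtain \<epsilon> where "\<epsilon> > 0" "\<forall>s\<in>{t-\<epsilon><..<t}. f s = c" by blast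
    then show "\<forall>\<^sub>F s in at_left t. f s = c"
      unfolding eventually_at_left_field by (intro exI[of _ "t - \<epsilon>"]) auto
  qed
  \<comment> \<open>The common radius for both sides splits into two independent ones; conversely
    their minimum serves both sides.\<close>
  have shrink: "(\<exists>\<epsilon>>0. \<exists>a b. (\<forall>s\<in>{t-\<epsilon><..<t}. f s = a) \<and> (\<forall>s\<in>{t<..<t+\<epsilon>}. f s = b) \<and> Q a b) \<longleftrightarrow>
      (\<exists>a b. (\<exists>\<epsilon>>0. \<forall>s\<in>{t-\<epsilon><..<t}. f s = a) \<and> (\<exists>\<epsilon>>0. \<forall>s\<in>{t<..<t+\<epsilon>}. f s = b) \<and> Q a b)" for t Q
  proof (intro iffI; clarify)
    fix a b and d e :: real
    assume "0 < d" "0 < e" "\<forall>s\<in>{t-d<..<t}. f s = a" "\<forall>s\<in>{t<..<t+e}. f s = b" "Q a b"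
    then show "\<exists>\<epsilon>>0. \<exists>a b. (\<forall>s\<in>{t-\<epsilon><..<t}. f s = a) \<and> (\<forall>s\<in>{t<..<t+\<epsilon>}. f s = b) \<and> Q a b"
      by (intro exI[of _ "min d e"] conjI exI[of _ a] exI[of _ b]) auto
  qed blast
  show ?thesis
    unfolding real_path_def R L shrink by auto
qed

section \<open>Left limits of real paths\<close>

lemma real_path_limitsE:
  assumes "real_path \<mu> Y f" "t \<in> {0<..<1}"
  obtains a b where "\<forall>\<^sub>F s in at_left t. f s = a" "\<forall>\<^sub>F s in at_right t. f s = b" "adj_or_eq \<mu> a b"
  using assms(1)[unfolded real_path_iff_eventually, THEN conjunct2, THEN conjunct2, THEN conjunct2,
      THEN bspec, OF assms(2)] by blast

text \<open>The values at 0 and 1 are kept because the two given maps prescribe them; at 1 the left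
  limit may differ from the prescribed value. At interior times the description has a unique
  solution whenever \<open>f\<close> is a real path.\<close>

definition left_val :: "(real \<Rightarrow> 'a) \<Rightarrow> real \<Rightarrow> 'a" where
  "left_val f t = (if t \<in> {0<..<1} then THE a. \<forall>\<^sub>F s in at_left t. f s = a else f t)"

text \<open>Left filters on the reals are nontrivial, so two eventual values are both taken at some
  common time and hence agree.\<close>

lemma left_val_eq:
  assumes "t \<in> {0<..<1}" "\<forall>\<^sub>F s in at_left t. f s = a"
  shows "left_val f t = a"
proof -
  have "b = a" if "\<forall>\<^sub>F s in at_left t. f s = b" for b
    using eventually_happens'[OF trivial_limit_at_left_real eventually_conj[OF that assms(2)]] by auto
  then have "(THE a. \<forall>\<^sub>F s in at_left t. f s = a) = a"
    using assms(2) by (intro the_equality)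
  then show ?thesis using assms(1) by (simp add: left_val_def)
qed

text \<open>This keeps points fixed: a constant track is not altered by passing to left
  limits.\<close>

lemma left_val_const: "(\<And>s. s \<in> {0..1} \<Longrightarrow> f s = c) \<Longrightarrow> t \<in> {0..1} \<Longrightarrow> left_val f t = c"
proof (cases "t \<in> {0<..<1}")
  case True
  assume "\<And>s. s \<in> {0..1} \<Longrightarrow> f s = c"
  then have "\<forall>\<^sub>F s in at_left t. f s = c"
    unfolding eventually_at_left_field using True by (intro exI[of _ 0]) auto
  then show ?thesis using True by (rule left_val_eq[rotated])
qed (auto simp: left_val_def)

text \<open>On an open interval where \<open>f\<close> is constant, every left limit is that
  constant. The cut at 0 keeps \<open>s\<close> among the interior times, where
  \<open>left_val\<close> is a limit. Allowing \<open>t = 1\<close> serves the final end of the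
  path.\<close>

lemma eventually_left_val_at_left:
  assumes "t \<in> {0<..1}" "\<forall>\<^sub>F s in at_left t. f s = a"
  shows "\<forall>\<^sub>F s in at_left t. left_val f s = a"
proof -
  obtain u where u: "u < t" "\<And>s. u < s \<Longrightarrow> s < t \<Longrightarrow> f s = a"
    using assms(2) unfolding eventually_at_left_field by blast
  have "left_val f s = a" if "max u 0 < s" "s < t" for s
    using that assms(1) u unfolding eventually_at_left_field
    by (intro left_val_eq) (auto simp: eventually_at_left_field intro!: exI[of _ u])
  then show ?thesis
    using u assms(1) unfolding eventually_at_left_field by (intro exI[of _ "max u 0"]) auto
qed

text \<open>Left neighbourhoods of a time \<open>s\<close> after \<open>t\<close> can be taken
  inside the interval from \<open>t\<close> to \<open>s\<close>, so the value at \<open>t\<close>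
  itself never interferes. Allowing \<open>t = 0\<close> serves the initial end of the path.\<close>

lemma eventually_left_val_at_right:
  assumes "t \<in> {0..<1}" "\<forall>\<^sub>F s in at_right t. f s = a"
  shows "\<forall>\<^sub>F s in at_right t. left_val f s = a"
proof -
  obtain u where u: "t < u" "\<And>s. t < s \<Longrightarrow> s < u \<Longrightarrow> f s = a"
    using assms(2) unfolding eventually_at_right_field by blast
  have "left_val f s = a" if "t < s" "s < min u 1" for s
    using that assms(1) u
    by (intro left_val_eq) (auto simp: eventually_at_left_field intro!: exI[of _ t])
  then show ?thesis
    using u assms(1) unfolding eventually_at_right_field by (intro exI[of _ "min u 1"]) auto
qed

lemma real_path_left_limit:
  assumes "real_path \<mu> Y f" "t \<in> {0<..<1}"
  shows "\<forall>\<^sub>F s in at_left t. f s = left_val f t"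
  using real_path_limitsE[OF assms] left_val_eq[OF assms(2)] by metis

text \<open>Both one-sided limits survive the replacement, and at interior times the new value is
  the left limit, so all adjacency conditions are inherited. The second claim is left-continuity in
  time, the property gained by the replacement.\<close>

lemma real_path_left_val:
  assumes f: "real_path \<mu> Y f"
  shows "real_path \<mu> Y (left_val f)"
    and "t \<in> {0<..<1} \<Longrightarrow> \<forall>\<^sub>F s in at_left t. left_val f s = left_val f t"
proof -
  have at_t: "(\<forall>\<^sub>F s in at_left t. left_val f s = left_val f t) \<and>
      (\<exists>b. (\<forall>\<^sub>F s in at_right t. left_val f s = b) \<and> adj_or_eq \<mu> (left_val f t) b)"
    if t: "t \<in> {0<..<1}" for t
  proof -
    obtain a b where ab: "\<forall>\<^sub>F s in at_left t. f s = a" "\<forall>\<^sub>F s in at_right t. f s = b" "adj_or_eq \<mu> a b"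
      by (rule real_path_limitsE[OF f t])
    have a: "left_val f t = a" by (rule left_val_eq[OF t ab(1)])
    have "t \<in> {0<..1}" "t \<in> {0..<1}" using t by auto
    then show ?thesis
      unfolding a
      using eventually_left_val_at_left[OF _ ab(1)] eventually_left_val_at_right[OF _ ab(2)] ab(3)
      by blast
  qed
  have "left_val f t \<in> Y" if "t \<in> {0..1}" for t
  proof (cases "t \<in> {0<..<1}")
    case True
    \<comment> \<open>The left limit is an actual value of \<open>f\<close> at some time in the unit
      interval, hence a point of \<open>Y\<close>.\<close>
    have "\<forall>\<^sub>F s in at_left t. 0 < s \<and> s < t"
      unfolding eventually_at_left_field using True by auto
    from eventually_happens'[OF trivial_limit_at_left_real
        eventually_conj[OF this real_path_left_limit[OF f True]]]
    obtain s where "0 < s" "s < t" "f s = left_val f t" by blast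
    moreover have "f ` {0..1} \<subseteq> Y" using f by (simp add: real_path_def)
    ultimately show ?thesis using True by (metis atLeastAtMost_iff greaterThanLessThan_iff
        image_subset_iff less_eq_real_def order_less_trans)
  qed (use f that in \<open>auto simp: left_val_def real_path_def\<close>)
  moreover have ends: "left_val f 0 = f 0" "left_val f 1 = f 1" by (auto simp: left_val_def)
  moreover obtain a b where
    a: "\<forall>\<^sub>F s in at_right 0. f s = a" "adj_or_eq \<mu> a (f 0)" and
    b: "\<forall>\<^sub>F s in at_left 1. f s = b" "adj_or_eq \<mu> b (f 1)"
    using f[unfolded real_path_iff_eventually] by meson
  moreover have "\<forall>\<^sub>F s in at_right 0. left_val f s = a" "\<forall>\<^sub>F s in at_left 1. left_val f s = b"
    using eventually_left_val_at_right[OF _ a(1)] eventually_left_val_at_left[OF _ b(1)] by simp_all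
  ultimately show "real_path \<mu> Y (left_val f)"
    unfolding real_path_iff_eventually
  proof (intro conjI ballI)
    fix t :: real assume t: "t \<in> {0<..<1}"
    show "\<exists>a b. (\<forall>\<^sub>F s in at_left t. left_val f s = a) \<and> (\<forall>\<^sub>F s in at_right t. left_val f s = b) \<and>
        adj_or_eq \<mu> a b \<and> (left_val f t = a \<or> left_val f t = b)"
      using at_t[OF t] by blast
  qed auto
  show "t \<in> {0<..<1} \<Longrightarrow> \<forall>\<^sub>F s in at_left t. left_val f s = left_val f t"
    using at_t by blast
qed

text \<open>For adjacent \<open>p\<close> and \<open>q\<close>, the left limits of both tracks at
  \<open>t\<close> are attained at one earlier time \<open>s\<close>, and continuity of the old
  slice at \<open>s\<close> makes them equal or adjacent. The time \<open>s\<close> depends on the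
  pair.\<close>

lemma is_real_homotopy_left_val:
  assumes F: "is_real_homotopy \<kappa> \<mu> X Y f g F"
    and sym: "\<And>p q. \<kappa> p q \<Longrightarrow> \<kappa> q p" "\<And>p q. \<mu> p q \<Longrightarrow> \<mu> q p"
  shows "is_real_homotopy \<kappa> \<mu> X Y f g (\<lambda>x. left_val (F x))"
proof -
  have paths: "real_path \<mu> Y (F x)" if "x \<in> X" for x
    using F that unfolding is_real_homotopy_def by blast
  have slices: "dig_continuous \<kappa> \<mu> X Y (\<lambda>x. F x t)" if "t \<in> {0..1}" for t
    using F that unfolding is_real_homotopy_def by blast
  have "dig_continuous \<kappa> \<mu> X Y (\<lambda>x. left_val (F x) t)" if t: "t \<in> {0..1}" for t
  proof (cases "t \<in> {0<..<1}")
    case True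
    have "adj_or_eq \<mu> (left_val (F p) t) (left_val (F q) t)" if pq: "p \<in> X" "q \<in> X" "\<kappa> p q" for p q
    proof -
      have "\<forall>\<^sub>F s in at_left t. 0 < s \<and> s < t"
        unfolding eventually_at_left_field using True by auto
      with real_path_left_limit[OF paths[OF pq(1)] True] real_path_left_limit[OF paths[OF pq(2)] True]
      have "\<forall>\<^sub>F s in at_left t. 0 < s \<and> s < t \<and> F p s = left_val (F p) t \<and> F q s = left_val (F q) t"
        by eventually_elim auto
      from eventually_happens'[OF trivial_limit_at_left_real this]
      obtain s where s: "0 < s" "s < t" "F p s = left_val (F p) t" "F q s = left_val (F q) t" by blast
      have "dig_continuous \<kappa> \<mu> X Y (\<lambda>x. F x s)" using s True by (intro slices) auto
      then have "adj_or_eq \<mu> (F p s) (F q s)"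
        using pq by (subst (asm) dig_continuous_iff) (auto intro: sym)
      then show ?thesis using s by simp
    qed
    moreover have "left_val (F x) t \<in> Y" if "x \<in> X" for x
      using real_path_left_val(1)[OF paths[OF that]] t by (auto simp: real_path_def)
    ultimately show ?thesis
      by (subst dig_continuous_iff) (auto intro: sym)
  next
    case False
    then have "(\<lambda>x. left_val (F x) t) = (\<lambda>x. F x t)" by (auto simp: left_val_def)
    then show ?thesis using slices[OF t] by simp
  qed
  then show ?thesis
    using F real_path_left_val(1)[OF paths] unfolding is_real_homotopy_def
    by (auto simp: left_val_def)
qed

section \<open>Products of left-continuous real paths\<close>

lemma eventually_point_prod:
  assumes "\<forall>i\<in>{1..k}. \<forall>\<^sub>F s in G. f i s = c i"
  shows "\<forall>\<^sub>F s in G. point_prod k (\<lambda>i. f i s) = point_prod k c"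
proof -
  have "\<forall>\<^sub>F s in G. \<forall>i\<in>{1..k}. f i s = c i"
    using assms by (intro eventually_ball_finite) auto
  then show ?thesis by eventually_elim (auto intro: point_prod_cong)
qed

lemma real_path_point_prod:
  assumes Y: "\<forall>i\<in>{1..k}. Y i \<subseteq> int_space (n i)"
    and f: "\<forall>i\<in>{1..k}. real_path (c_adj (n i) (n i)) (Y i) (f i)"
    and left: "\<And>i t. i \<in> {1..k} \<Longrightarrow> t \<in> {0<..<1} \<Longrightarrow> \<forall>\<^sub>F s in at_left t. f i s = f i t"
  shows "real_path (c_adj (\<Sum>i=1..k. n i) (\<Sum>i=1..k. n i)) (image_prod k Y)
    (\<lambda>t. point_prod k (\<lambda>i. f i t))"
proof -
  let ?c = "\<lambda>i. c_adj (n i) (n i)" and ?D = "\<Sum>i=1..k. n i"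
  have inY: "f i t \<in> Y i" if "i \<in> {1..k}" "t \<in> {0..1}" for i t
    using f that unfolding real_path_def by blast
  have len: "length (f i t) = n i" if "i \<in> {1..k}" "t \<in> {0..1}" for i t
    using inY[OF that] Y that by (auto simp: int_space_def)
  \<comment> \<open>A limit gets its length from a value of the path to which it is equal or
    adjacent.\<close>
  have adj_len: "length c = n i" if "adj_or_eq (?c i) c d \<or> adj_or_eq (?c i) d c" "length d = n i" for i c d
    using that by (auto simp: adj_or_eq_def c_adj_full_iff)
  \<comment> \<open>The filter is arbitrary because the same argument is used three times: to the
    right of 0, to the left of 1, and to the right of an interior time.\<close>
  have ends: "\<exists>c. (\<forall>\<^sub>F s in G. point_prod k (\<lambda>i. f i s) = c) \<and>
      adj_or_eq (c_adj ?D ?D) c (point_prod k (\<lambda>i. f i t))"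
    if t: "t \<in> {0..1}" and
      ex: "\<forall>i\<in>{1..k}. \<exists>c. (\<forall>\<^sub>F s in G. f i s = c) \<and> adj_or_eq (?c i) c (f i t)" for t G
  proof -
    from ex[unfolded bchoice_iff] obtain c where
      c: "\<forall>i\<in>{1..k}. \<forall>\<^sub>F s in G. f i s = c i"
        "\<forall>i\<in>{1..k}. adj_or_eq (?c i) (c i) (f i t)" by blast
    have "adj_or_eq (c_adj ?D ?D) (point_prod k c) (point_prod k (\<lambda>i. f i t))"
      using c(2) len t adj_len by (intro adj_or_eq_point_prod) blast+
    then show ?thesis using eventually_point_prod[OF c(1)] by blast
  qed
  have adj_sym: "adj_or_eq (c_adj m m) p q \<longleftrightarrow> adj_or_eq (c_adj m m) q p" for m p q
    using c_adj_full_sym by (auto simp: adj_or_eq_def)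
  show ?thesis
    unfolding real_path_iff_eventually
  proof (intro conjI ballI)
    show "(\<lambda>t. point_prod k (\<lambda>i. f i t)) ` {0..1} \<subseteq> image_prod k Y"
      using inY by (auto intro!: image_prodI)
    show "\<exists>c. (\<forall>\<^sub>F s in at_right 0. point_prod k (\<lambda>i. f i s) = c) \<and>
        adj_or_eq (c_adj ?D ?D) c (point_prod k (\<lambda>i. f i 0))"
      using f unfolding real_path_iff_eventually by (intro ends) auto
    show "\<exists>c. (\<forall>\<^sub>F s in at_left 1. point_prod k (\<lambda>i. f i s) = c) \<and>
        adj_or_eq (c_adj ?D ?D) c (point_prod k (\<lambda>i. f i 1))"
      using f unfolding real_path_iff_eventually by (intro ends) auto
    fix t :: real assume t: "t \<in> {0<..<1}"
    \<comment> \<open>Left-continuity identifies the left limit with the value at \<open>t\<close>,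
      so the adjacency of the two limits becomes adjacency of the right limit to the value, as
      \<open>ends\<close> requires.\<close>
    have "\<exists>b. (\<forall>\<^sub>F s in at_right t. f i s = b) \<and> adj_or_eq (?c i) b (f i t)" if i: "i \<in> {1..k}" for i
    proof -
      obtain a b where ab: "\<forall>\<^sub>F s in at_left t. f i s = a" "\<forall>\<^sub>F s in at_right t. f i s = b"
          "adj_or_eq (?c i) a b"
        by (rule real_path_limitsE[OF f[rule_format, OF i] t])
      have "a = f i t"
        using eventually_happens'[OF trivial_limit_at_left_real
            eventually_conj[OF ab(1) left[OF i t]]] by auto
      then show ?thesis using ab adj_sym by blast
    qed
    then obtain b where "\<forall>\<^sub>F s in at_right t. point_prod k (\<lambda>i. f i s) = b"
        "adj_or_eq (c_adj ?D ?D) b (point_prod k (\<lambda>i. f i t))"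
      using ends[of t "at_right t"] t by auto
    moreover have "\<forall>\<^sub>F s in at_left t. point_prod k (\<lambda>i. f i s) = point_prod k (\<lambda>i. f i t)"
      using left t by (intro eventually_point_prod) auto
    ultimately show "\<exists>a b. (\<forall>\<^sub>F s in at_left t. point_prod k (\<lambda>i. f i s) = a) \<and>
        (\<forall>\<^sub>F s in at_right t. point_prod k (\<lambda>i. f i s) = b) \<and> adj_or_eq (c_adj ?D ?D) a b \<and>
        (point_prod k (\<lambda>i. f i t) = a \<or> point_prod k (\<lambda>i. f i t) = b)"
      using adj_sym by blast
  qed
qed

lemma multiplicative_real_homotopic_rel: "multiplicative k n real_homotopic_rel"
  unfolding multiplicative_def
proof (intro allI impI)
  fix X Y A f g \<phi> \<psi>
  let ?c = "\<lambda>i. c_adj (n i) (n i)"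
  assume h: "\<forall>i\<in>{1..k}. X i \<subseteq> int_space (n i) \<and> Y i \<subseteq> int_space (n i) \<and> A i \<subseteq> X i \<and>
      real_homotopic_rel (?c i) (?c i) (X i) (Y i) (A i) (f i) (g i)"
    and \<phi>: "represents_prod_map k X f \<phi>" and \<psi>: "represents_prod_map k X g \<psi>"
  then have X: "\<forall>i\<in>{1..k}. X i \<subseteq> int_space (n i)"
    and Y: "\<forall>i\<in>{1..k}. Y i \<subseteq> int_space (n i)"
    and A_space: "\<forall>i\<in>{1..k}. A i \<subseteq> int_space (n i)" by blast+
  have "\<forall>i\<in>{1..k}. \<exists>F. is_real_homotopy (?c i) (?c i) (X i) (Y i) (f i) (g i) F \<and>
      (\<forall>a\<in>A i. \<forall>t\<in>{0..1}. F a t = F a 0)"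
    using h by (simp add: real_homotopic_rel_def)
  from this[unfolded bchoice_iff] obtain G where
    G: "\<forall>i\<in>{1..k}. is_real_homotopy (?c i) (?c i) (X i) (Y i) (f i) (g i) (G i)"
    and GA: "\<And>i a t. i \<in> {1..k} \<Longrightarrow> a \<in> A i \<Longrightarrow> t \<in> {0..1} \<Longrightarrow> G i a t = G i a 0"
    by blast
  define F where "F i a = left_val (G i a)" for i a
  have F: "is_real_homotopy (?c i) (?c i) (X i) (Y i) (f i) (g i) (F i)" if "i \<in> {1..k}" for i
    unfolding F_def using is_real_homotopy_left_val[OF G[rule_format, OF that] c_adj_full_sym c_adj_full_sym]
    by blast
  have left: "\<forall>\<^sub>F s in at_left t. F i a s = F i a t"
    if "i \<in> {1..k}" "a \<in> X i" "t \<in> {0<..<1}" for i a t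
    unfolding F_def
  proof (rule real_path_left_val(2)[OF _ that(3)])
    show "real_path (?c i) (Y i) (G i a)"
      using G[rule_format, OF that(1)] that(2) by (simp add: is_real_homotopy_def)
  qed
  have FA: "F i a t = F i a 0" if "i \<in> {1..k}" "a \<in> A i" "t \<in> {0..1}" for i a t
  proof -
    have "left_val (G i a) s = G i a 0" if "s \<in> {0..1}" for s
      by (rule left_val_const[OF _ that]) (rule GA[OF \<open>i \<in> {1..k}\<close> \<open>a \<in> A i\<close>])
    then show ?thesis using that by (simp add: F_def)
  qed
  let ?D = "\<Sum>i=1..k. n i" and ?F = "\<lambda>p t. prod_map k n (\<lambda>i a. F i a t) p"
  have blk: "block n i p \<in> X i" if "i \<in> {1..k}" "p \<in> image_prod k X" for i p
    using block_in_factor[OF X] that by blast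
  have "is_real_homotopy (c_adj ?D ?D) (c_adj ?D ?D) (image_prod k X) (image_prod k Y) \<phi> \<psi> ?F"
    unfolding is_real_homotopy_def
  proof (intro conjI ballI)
    show "dig_continuous (c_adj ?D ?D) (c_adj ?D ?D) (image_prod k X) (image_prod k Y) \<phi>"
      by (rule dig_continuous_represents[OF X Y _ \<phi>]) (use F in \<open>auto simp: is_real_homotopy_def\<close>)
    show "dig_continuous (c_adj ?D ?D) (c_adj ?D ?D) (image_prod k X) (image_prod k Y) \<psi>"
      by (rule dig_continuous_represents[OF X Y _ \<psi>]) (use F in \<open>auto simp: is_real_homotopy_def\<close>)
    fix p assume p: "p \<in> image_prod k X"
    have ends: "F i (block n i p) 0 = f i (block n i p)" "F i (block n i p) 1 = g i (block n i p)"
      if "i \<in> {1..k}" for i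
      using F[OF that] blk[OF that p] by (auto simp: is_real_homotopy_def)
    show "?F p 0 = \<phi> p" "?F p 1 = \<psi> p"
      unfolding represents_prod_map_eq[OF X \<phi> p] represents_prod_map_eq[OF X \<psi> p] prod_map_def
      by (intro point_prod_cong ends; assumption)+
    show "real_path (c_adj ?D ?D) (image_prod k Y) (?F p)"
      unfolding prod_map_def
      by (rule real_path_point_prod[OF Y _ left])
        (use F blk p in \<open>auto simp: is_real_homotopy_def\<close>)
  next
    fix t :: real assume "t \<in> {0..1}"
    then show "dig_continuous (c_adj ?D ?D) (c_adj ?D ?D) (image_prod k X) (image_prod k Y)
        (\<lambda>p. ?F p t)"
      using F by (intro dig_continuous_prod_map X Y) (auto simp: is_real_homotopy_def)
  qed
  moreover have "?F p t = ?F p 0" if "p \<in> image_prod k A" "t \<in> {0..1}" for p t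
  proof -
    have blkA: "block n i p \<in> A i" if "i \<in> {1..k}" for i
      using block_in_factor[OF A_space \<open>p \<in> _\<close> that] .
    have "F i (block n i p) t = F i (block n i p) 0" if "i \<in> {1..k}" for i
      by (rule FA[OF that _ \<open>t \<in> _\<close>]) (rule blkA[OF that])
    then show ?thesis
      unfolding prod_map_def by (rule point_prod_cong)
  qed
  ultimately show "real_homotopic_rel (c_adj ?D ?D) (c_adj ?D ?D) (image_prod k X) (image_prod k Y)
      (image_prod k A) \<phi> \<psi>"
    unfolding real_homotopic_rel_def by blast
qed

subsection \<open>Homotopic similarity\<close>

definition similar_rel where
  "similar_rel \<kappa> \<mu> X A Y B \<longleftrightarrow> (\<exists>X' Y' f g.
     exhausts X' X \<and> exhausts Y' Y \<and> A \<subseteq> X' 1 \<and> B \<subseteq> Y' 1 \<and>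
     (\<forall>j\<ge>1. dig_continuous \<kappa> \<mu> (X' j) (Y' j) (f j) \<and> dig_continuous \<mu> \<kappa> (Y' j) (X' j) (g j) \<and>
        f j ` A \<subseteq> B \<and> g j ` B \<subseteq> A \<and>
        homotopic_rel \<kappa> \<kappa> (X' j) (X' j) A (g j \<circ> f j) id \<and>
        homotopic_rel \<mu> \<mu> (Y' j) (Y' j) B (f j \<circ> g j) id) \<and>
     (\<forall>v\<ge>1. \<forall>w\<ge>v. homotopic_rel \<kappa> \<mu> (X' v) (Y' v) A (f w) (f v) \<and>
        homotopic_rel \<mu> \<kappa> (Y' v) (X' v) B (g w) (g v)))"

lemma exhausts_mono:
  assumes "exhausts X' X" "1 \<le> v" "v \<le> w"
  shows "X' v \<subseteq> X' w"
  using assms(3)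
proof (induction w rule: dec_induct)
  case (step w)
  then show ?case using assms(1,2) unfolding exhausts_def by (meson order_trans)
qed simp

text \<open>Each component of a point enters the exhaustion of its factor at its own level. There
  are finitely many components and the levels increase, so the largest of these levels contains the
  whole point.\<close>

lemma exhausts_image_prod:
  assumes "\<forall>i\<in>{1..k}. exhausts (X' i) (X i)"
  shows "exhausts (\<lambda>j. image_prod k (\<lambda>i. X' i j)) (image_prod k X)"
proof -
  have sub: "image_prod k (\<lambda>i. X' i j) \<subseteq> image_prod k X" if "1 \<le> j" for j
    using assms that by (intro image_prod_mono) (auto simp: exhausts_def)
  have step: "image_prod k (\<lambda>i. X' i j) \<subseteq> image_prod k (\<lambda>i. X' i (Suc j))" if "1 \<le> j" for j
    using assms that by (intro image_prod_mono) (auto simp: exhausts_def)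
  have cover: "\<exists>j\<ge>1. p \<in> image_prod k (\<lambda>i. X' i j)" if p: "p \<in> image_prod k X" for p
  proof -
    obtain x where x: "p = point_prod k x" "\<forall>i\<in>{1..k}. x i \<in> X i"
      using p by (rule image_prodE) blast
    have "\<forall>i\<in>{1..k}. \<exists>j\<ge>1. x i \<in> X' i j"
      using assms x(2) unfolding exhausts_def by blast
    from this[unfolded bchoice_iff] obtain j where
      j: "\<forall>i\<in>{1..k}. 1 \<le> j i" "\<forall>i\<in>{1..k}. x i \<in> X' i (j i)" by blast
    define M where "M = Max (insert 1 (j ` {1..k}))"
    have "x i \<in> X' i M" if "i \<in> {1..k}" for i
    proof -
      have "j i \<le> M" unfolding M_def using that by (intro Max_ge) auto
      then show ?thesis
        using exhausts_mono[OF assms[rule_format, OF that] j(1)[rule_format, OF that]] j(2) that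
        by blast
    qed
    then have "p \<in> image_prod k (\<lambda>i. X' i M)"
      unfolding x(1) by (intro image_prodI ballI)
    moreover have "1 \<le> M" unfolding M_def by (rule Max_ge) auto
    ultimately show ?thesis by blast
  qed
  have "image_prod k X = (\<Union>j\<in>{1..}. image_prod k (\<lambda>i. X' i j))"
  proof (intro subset_antisym subsetI)
    fix p assume "p \<in> image_prod k X"
    then obtain j where "1 \<le> j" "p \<in> image_prod k (\<lambda>i. X' i j)" using cover by blast
    then show "p \<in> (\<Union>j\<in>{1..}. image_prod k (\<lambda>i. X' i j))" by (intro UN_I) auto
  qed (use sub in auto)
  then show ?thesis
    unfolding exhausts_def using sub step by (intro conjI allI impI)
qed

lemma similar_rel_image_prod:
  assumes X: "\<forall>i\<in>{1..k}. X i \<subseteq> int_space (n i)"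
    and Y: "\<forall>i\<in>{1..k}. Y i \<subseteq> int_space (n i)"
    and s: "\<forall>i\<in>{1..k}. similar_rel (c_adj (n i) (n i)) (c_adj (n i) (n i)) (X i) (A i) (Y i) (B i)"
  shows "similar_rel (c_adj (\<Sum>i=1..k. n i) (\<Sum>i=1..k. n i)) (c_adj (\<Sum>i=1..k. n i) (\<Sum>i=1..k. n i))
    (image_prod k X) (image_prod k A) (image_prod k Y) (image_prod k B)"
proof -
  let ?c = "\<lambda>i. c_adj (n i) (n i)" and ?D = "\<Sum>i=1..k. n i"
  define S where "S i X' Y' f g \<longleftrightarrow>
      (exhausts X' (X i) \<and> exhausts Y' (Y i) \<and> A i \<subseteq> X' 1 \<and> B i \<subseteq> Y' 1 \<and>
      (\<forall>j\<ge>1. dig_continuous (?c i) (?c i) (X' j) (Y' j) (f j) \<and>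
        dig_continuous (?c i) (?c i) (Y' j) (X' j) (g j) \<and>
        f j ` A i \<subseteq> B i \<and> g j ` B i \<subseteq> A i \<and>
        homotopic_rel (?c i) (?c i) (X' j) (X' j) (A i) (g j \<circ> f j) id \<and>
        homotopic_rel (?c i) (?c i) (Y' j) (Y' j) (B i) (f j \<circ> g j) id) \<and>
      (\<forall>v\<ge>1. \<forall>w\<ge>v. homotopic_rel (?c i) (?c i) (X' v) (Y' v) (A i) (f w) (f v) \<and>
        homotopic_rel (?c i) (?c i) (Y' v) (X' v) (B i) (g w) (g v)))" for i X' Y' f g
  have "\<forall>i\<in>{1..k}. \<exists>X' Y' f g. S i X' Y' f g"
    using s unfolding similar_rel_def S_def .
  from this[unfolded bchoice_iff] obtain X' Y' f g where
    S: "\<forall>i\<in>{1..k}. S i (X' i) (Y' i) (f i) (g i)" by blast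
  have h: "\<forall>i\<in>{1..k}. exhausts (X' i) (X i) \<and> exhausts (Y' i) (Y i) \<and>
       A i \<subseteq> X' i 1 \<and> B i \<subseteq> Y' i 1"
    using S by (simp add: S_def)
  have hj: "dig_continuous (?c i) (?c i) (X' i j) (Y' i j) (f i j) \<and>
       dig_continuous (?c i) (?c i) (Y' i j) (X' i j) (g i j) \<and>
       f i j ` A i \<subseteq> B i \<and> g i j ` B i \<subseteq> A i \<and>
       homotopic_rel (?c i) (?c i) (X' i j) (X' i j) (A i) (g i j \<circ> f i j) id \<and>
       homotopic_rel (?c i) (?c i) (Y' i j) (Y' i j) (B i) (f i j \<circ> g i j) id"
    if "i \<in> {1..k}" "1 \<le> j" for i j
    using S[rule_format, OF that(1)] that(2) by (simp add: S_def)
  have hvw: "homotopic_rel (?c i) (?c i) (X' i v) (Y' i v) (A i) (f i w) (f i v) \<and>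
       homotopic_rel (?c i) (?c i) (Y' i v) (X' i v) (B i) (g i w) (g i v)"
    if "i \<in> {1..k}" "1 \<le> v" "v \<le> w" for i v w
    using S[rule_format, OF that(1)] that(2,3) by (simp add: S_def)
  let ?X = "\<lambda>j i. X' i j" and ?Y = "\<lambda>j i. Y' i j"
  let ?f = "\<lambda>j. prod_map k n (\<lambda>i. f i j)" and ?g = "\<lambda>j. prod_map k n (\<lambda>i. g i j)"
  \<comment> \<open>Compatibility with products needs the fixed set inside the current level; it
    lies in level 1 and therefore in all later ones.\<close>
  have X'_bounds: "A i \<subseteq> X' i j \<and> X' i j \<subseteq> int_space (n i)" if i: "i \<in> {1..k}" and j: "1 \<le> j" for i j
  proof -
    have e: "exhausts (X' i) (X i)" "A i \<subseteq> X' i 1" using h[rule_format, OF i] by auto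
    have "X' i j \<subseteq> X i" using e(1) j unfolding exhausts_def by blast
    then show ?thesis using exhausts_mono[OF e(1) _ j] e(2) X[rule_format, OF i] by auto
  qed
  have Y'_bounds: "B i \<subseteq> Y' i j \<and> Y' i j \<subseteq> int_space (n i)" if i: "i \<in> {1..k}" and j: "1 \<le> j" for i j
  proof -
    have e: "exhausts (Y' i) (Y i)" "B i \<subseteq> Y' i 1" using h[rule_format, OF i] by auto
    have "Y' i j \<subseteq> Y i" using e(1) j unfolding exhausts_def by blast
    then show ?thesis using exhausts_mono[OF e(1) _ j] e(2) Y[rule_format, OF i] by auto
  qed
  note X' = conjunct2[OF X'_bounds] and A = conjunct1[OF X'_bounds]
    and Y' = conjunct2[OF Y'_bounds] and B = conjunct1[OF Y'_bounds]
  \<comment> \<open>The level \<open>j\<close> and the index \<open>w\<close> are independent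
    because the coherence homotopies restrict \<open>f w\<close> to an earlier level
    \<open>v\<close>.\<close>
  have rf: "represents_prod_map k (?X j) (\<lambda>i. f i w) (?f w)"
    and rg: "represents_prod_map k (?Y j) (\<lambda>i. g i w) (?g w)" if "1 \<le> j" for j w
    by (rule represents_prod_map; use X' Y' that in blast)+
  have im: "f i j ` X' i j \<subseteq> Y' i j" "g i j ` Y' i j \<subseteq> X' i j" if "i \<in> {1..k}" "1 \<le> j" for i j
    using hj[OF that] by (auto simp: dig_continuous_def)
  have gf: "represents_prod_map k (?X j) (\<lambda>i. g i j \<circ> f i j) (?g j \<circ> ?f j)" if "1 \<le> j" for j
    using rf[OF that] rg[OF that] by (rule represents_prod_map_comp) (use im that in blast)
  have fg: "represents_prod_map k (?Y j) (\<lambda>i. f i j \<circ> g i j) (?f j \<circ> ?g j)" if "1 \<le> j" for j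
    using rg[OF that] rf[OF that] by (rule represents_prod_map_comp) (use im that in blast)
  note mult = multiplicative_homotopic_rel[of k n, unfolded multiplicative_def, THEN spec, THEN spec,
      THEN spec, THEN spec, THEN spec, THEN spec, THEN spec, THEN mp, THEN mp, THEN mp]
  show ?thesis
    unfolding similar_rel_def
  proof (intro exI conjI allI impI)
    show "exhausts (\<lambda>j. image_prod k (?X j)) (image_prod k X)"
      "exhausts (\<lambda>j. image_prod k (?Y j)) (image_prod k Y)"
      using h by (auto intro!: exhausts_image_prod)
    show "image_prod k A \<subseteq> image_prod k (?X 1)" "image_prod k B \<subseteq> image_prod k (?Y 1)"
      using h by (auto intro!: image_prod_mono)
  next
    fix j :: nat assume j: "1 \<le> j"
    show "dig_continuous (c_adj ?D ?D) (c_adj ?D ?D) (image_prod k (?X j)) (image_prod k (?Y j)) (?f j)"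
      "dig_continuous (c_adj ?D ?D) (c_adj ?D ?D) (image_prod k (?Y j)) (image_prod k (?X j)) (?g j)"
      by (rule dig_continuous_prod_map; use X' Y' hj j in blast)+
    show "?f j ` image_prod k A \<subseteq> image_prod k B"
      by (rule represents_prod_map_image[OF rf[OF j]]; use A hj j in blast)
    show "?g j ` image_prod k B \<subseteq> image_prod k A"
      by (rule represents_prod_map_image[OF rg[OF j]]; use B hj j in blast)
    show "homotopic_rel (c_adj ?D ?D) (c_adj ?D ?D) (image_prod k (?X j)) (image_prod k (?X j))
        (image_prod k A) (?g j \<circ> ?f j) id"
      by (rule mult[OF _ gf[OF j] represents_prod_map_id]) (use j X' A hj in blast)
    show "homotopic_rel (c_adj ?D ?D) (c_adj ?D ?D) (image_prod k (?Y j)) (image_prod k (?Y j))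
        (image_prod k B) (?f j \<circ> ?g j) id"
      by (rule mult[OF _ fg[OF j] represents_prod_map_id]) (use j Y' B hj in blast)
  next
    fix v w :: nat assume vw: "1 \<le> v" "v \<le> w"
    show "homotopic_rel (c_adj ?D ?D) (c_adj ?D ?D) (image_prod k (?X v)) (image_prod k (?Y v))
        (image_prod k A) (?f w) (?f v)"
      by (rule mult[OF _ rf[OF vw(1)] rf[OF vw(1)]]) (use vw X' Y' A hvw in blast)
    show "homotopic_rel (c_adj ?D ?D) (c_adj ?D ?D) (image_prod k (?Y v)) (image_prod k (?X v))
        (image_prod k B) (?g w) (?g v)"
      by (rule mult[OF _ rg[OF vw(1)] rg[OF vw(1)]]) (use vw X' Y' B hvw in blast)
  qed
qed

section \<open>The free and the pointed notions\<close>

lemma homotopy_equiv_iff_rel: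
  "homotopy_equiv \<kappa> \<mu> X Y \<longleftrightarrow> equiv_rel homotopic_rel \<kappa> \<mu> X {} Y {}"
  by (simp add: homotopy_equiv_def equiv_rel_def homotopic_def homotopic_rel_def)

lemma pointed_homotopy_equiv_iff_rel:
  "pointed_homotopy_equiv \<kappa> \<mu> X x Y y \<longleftrightarrow> equiv_rel homotopic_rel \<kappa> \<mu> X {x} Y {y}"
  by (simp add: pointed_homotopy_equiv_def equiv_rel_def homotopic_fixing_def homotopic_rel_def)

lemma long_homotopy_equiv_iff_rel:
  "long_homotopy_equiv \<kappa> \<mu> X Y \<longleftrightarrow> equiv_rel long_homotopic_rel \<kappa> \<mu> X {} Y {}"
  by (simp add: long_homotopy_equiv_def equiv_rel_def long_homotopic_def long_homotopic_rel_def)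

lemma pointed_long_homotopy_equiv_iff_rel:
  "pointed_long_homotopy_equiv \<kappa> \<mu> X x Y y \<longleftrightarrow> equiv_rel long_homotopic_rel \<kappa> \<mu> X {x} Y {y}"
  by (simp add: pointed_long_homotopy_equiv_def equiv_rel_def long_homotopic_fixing_def
      long_homotopic_rel_def)

lemma real_homotopy_equiv_iff_rel:
  "real_homotopy_equiv \<kappa> \<mu> X Y \<longleftrightarrow> equiv_rel real_homotopic_rel \<kappa> \<mu> X {} Y {}"
  by (simp add: real_homotopy_equiv_def equiv_rel_def real_homotopic_def real_homotopic_rel_def)

text \<open>One side keeps the track at \<open>x\<close>, the other at its starting value
  \<open>F x 0\<close>. These agree because \<open>F x 0 = f x = x\<close>.\<close>

lemma real_homotopic_fixing_iff_rel:
  assumes "x \<in> X" "f x = x"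
  shows "real_homotopic_fixing \<kappa> X x f g \<longleftrightarrow> real_homotopic_rel \<kappa> \<kappa> X X {x} f g"
proof -
  have F0: "F x 0 = x" if "is_real_homotopy \<kappa> \<kappa> X X f g F" for F
    using that assms by (simp add: is_real_homotopy_def)
  have "(is_real_homotopy \<kappa> \<kappa> X X f g F \<and> (\<forall>t\<in>{0..1}. F x t = x)) \<longleftrightarrow>
      (is_real_homotopy \<kappa> \<kappa> X X f g F \<and> (\<forall>a\<in>{x}. \<forall>t\<in>{0..1}. F a t = F a 0))" for F
    by (cases "is_real_homotopy \<kappa> \<kappa> X X f g F") (simp_all add: F0[of F])
  then show ?thesis
    unfolding real_homotopic_fixing_def real_homotopic_rel_def by simp
qed

text \<open>The base point conditions on \<open>f\<close> and \<open>g\<close> make \<open>x\<close>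
  a fixed point of \<open>g\<close> after \<open>f\<close> and \<open>y\<close> one of
  \<open>f\<close> after \<open>g\<close>, which is what the previous lemma asks for.\<close>

lemma pointed_real_homotopy_equiv_iff_rel:
  assumes "x \<in> X" "y \<in> Y"
  shows "pointed_real_homotopy_equiv \<kappa> \<mu> X x Y y \<longleftrightarrow> equiv_rel real_homotopic_rel \<kappa> \<mu> X {x} Y {y}"
proof -
  have "f x = y \<and> g y = x \<and> real_homotopic_fixing \<kappa> X x (g \<circ> f) id \<and>
      real_homotopic_fixing \<mu> Y y (f \<circ> g) id \<longleftrightarrow>
    f ` {x} \<subseteq> {y} \<and> g ` {y} \<subseteq> {x} \<and> real_homotopic_rel \<kappa> \<kappa> X X {x} (g \<circ> f) id \<and>
      real_homotopic_rel \<mu> \<mu> Y Y {y} (f \<circ> g) id" for f g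
    using assms by (auto simp: real_homotopic_fixing_iff_rel)
  then show ?thesis
    unfolding pointed_real_homotopy_equiv_def equiv_rel_def by simp
qed

lemma homotopically_similar_iff_rel:
  "homotopically_similar \<kappa> \<mu> X Y \<longleftrightarrow> similar_rel \<kappa> \<mu> X {} Y {}"
  by (simp add: homotopically_similar_def similar_rel_def homotopic_def homotopic_rel_def)

lemma pointed_homotopically_similar_iff_rel:
  "pointed_homotopically_similar \<kappa> \<mu> X x Y y \<longleftrightarrow> similar_rel \<kappa> \<mu> X {x} Y {y}"
  by (simp add: pointed_homotopically_similar_def similar_rel_def homotopic_fixing_def
      homotopic_rel_def)

theorem theorem8p4:
  fixes k D :: nat
    and n :: "nat \<Rightarrow> nat"
    and X Y :: "nat \<Rightarrow> int list set"
    and x y :: "nat \<Rightarrow> int list"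
    and x\<^sub>0 y\<^sub>0 :: "int list"
  assumes "k \<ge> 1"
    and "\<forall>i\<in>{1..k}. n i \<ge> 1"
    and "D = (\<Sum>i=1..k. n i)"
    and "\<forall>i\<in>{1..k}. digital_image (n i) (X i) (c_adj (n i) (n i))"
    and "\<forall>i\<in>{1..k}. digital_image (n i) (Y i) (c_adj (n i) (n i))"
    and "\<forall>i\<in>{1..k}. x i \<in> X i"
    and "\<forall>i\<in>{1..k}. y i \<in> Y i"
    and "x\<^sub>0 = point_prod k x"
    and "y\<^sub>0 = point_prod k y"
  shows
    "(((\<forall>i\<in>{1..k}. homotopy_equiv (c_adj (n i) (n i)) (c_adj (n i) (n i)) (X i) (Y i)) \<longrightarrow>
        homotopy_equiv (c_adj D D) (c_adj D D) (image_prod k X) (image_prod k Y)) \<and>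
     ((\<forall>i\<in>{1..k}. pointed_homotopy_equiv
          (c_adj (n i) (n i)) (c_adj (n i) (n i)) (X i) (x i) (Y i) (y i)) \<longrightarrow>
        pointed_homotopy_equiv
          (c_adj D D) (c_adj D D) (image_prod k X) x\<^sub>0 (image_prod k Y) y\<^sub>0)) \<and>
     (((\<forall>i\<in>{1..k}. homotopically_similar (c_adj (n i) (n i)) (c_adj (n i) (n i)) (X i) (Y i)) \<longrightarrow>
        homotopically_similar (c_adj D D) (c_adj D D) (image_prod k X) (image_prod k Y)) \<and>
     ((\<forall>i\<in>{1..k}. pointed_homotopically_similar
          (c_adj (n i) (n i)) (c_adj (n i) (n i)) (X i) (x i) (Y i) (y i)) \<longrightarrow>
        pointed_homotopically_similar
          (c_adj D D) (c_adj D D) (image_prod k X) x\<^sub>0 (image_prod k Y) y\<^sub>0)) \<and>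
     (((\<forall>i\<in>{1..k}. long_homotopy_equiv (c_adj (n i) (n i)) (c_adj (n i) (n i)) (X i) (Y i)) \<longrightarrow>
        long_homotopy_equiv (c_adj D D) (c_adj D D) (image_prod k X) (image_prod k Y)) \<and>
     ((\<forall>i\<in>{1..k}. pointed_long_homotopy_equiv
          (c_adj (n i) (n i)) (c_adj (n i) (n i)) (X i) (x i) (Y i) (y i)) \<longrightarrow>
        pointed_long_homotopy_equiv
          (c_adj D D) (c_adj D D) (image_prod k X) x\<^sub>0 (image_prod k Y) y\<^sub>0)) \<and>
     (((\<forall>i\<in>{1..k}. real_homotopy_equiv (c_adj (n i) (n i)) (c_adj (n i) (n i)) (X i) (Y i)) \<longrightarrow>
        real_homotopy_equiv (c_adj D D) (c_adj D D) (image_prod k X) (image_prod k Y)) \<and>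
     ((\<forall>i\<in>{1..k}. pointed_real_homotopy_equiv
          (c_adj (n i) (n i)) (c_adj (n i) (n i)) (X i) (x i) (Y i) (y i)) \<longrightarrow>
        pointed_real_homotopy_equiv
          (c_adj D D) (c_adj D D) (image_prod k X) x\<^sub>0 (image_prod k Y) y\<^sub>0))"
proof -
  have X: "\<forall>i\<in>{1..k}. X i \<subseteq> int_space (n i)"
    and Y: "\<forall>i\<in>{1..k}. Y i \<subseteq> int_space (n i)"
    using assms(4,5) by (auto simp: digital_image_def)
  have x: "x i \<in> X i" and y: "y i \<in> Y i" if "i \<in> {1..k}" for i
    using assms(6,7) that by auto
  have x0: "x\<^sub>0 \<in> image_prod k X" "y\<^sub>0 \<in> image_prod k Y"
    unfolding assms(8,9) using x y by (auto intro: image_prodI)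
  note free = image_prod_empty[OF assms(1)]
  note pointed = image_prod_singletons[of k x, folded assms(8)] image_prod_singletons[of k y, folded assms(9)]
  \<comment> \<open>\<open>H\<close> is left open, so \<open>E\<close> and \<open>P\<close> each
    settle the finite, the long and the real case.\<close>
  have E: "equiv_rel H (c_adj D D) (c_adj D D) (image_prod k X) {} (image_prod k Y) {}"
    if "multiplicative k n H"
      "\<forall>i\<in>{1..k}. equiv_rel H (c_adj (n i) (n i)) (c_adj (n i) (n i)) (X i) {} (Y i) {}" for H
    using equiv_rel_image_prod[of k n H X Y "\<lambda>_. {}" "\<lambda>_. {}"] that X Y
    by (simp add: free assms(3))
  have P: "equiv_rel H (c_adj D D) (c_adj D D) (image_prod k X) {x\<^sub>0} (image_prod k Y) {y\<^sub>0}"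
    if "multiplicative k n H"
      "\<forall>i\<in>{1..k}. equiv_rel H (c_adj (n i) (n i)) (c_adj (n i) (n i)) (X i) {x i} (Y i) {y i}" for H
    using equiv_rel_image_prod[of k n H X Y "\<lambda>i. {x i}" "\<lambda>i. {y i}"] that X Y x y
    by (simp add: pointed assms(3))
  have ES: "similar_rel (c_adj D D) (c_adj D D) (image_prod k X) {} (image_prod k Y) {}"
    if "\<forall>i\<in>{1..k}. similar_rel (c_adj (n i) (n i)) (c_adj (n i) (n i)) (X i) {} (Y i) {}"
    using similar_rel_image_prod[of k X n Y "\<lambda>_. {}" "\<lambda>_. {}"] that X Y
    by (simp add: free assms(3))
  have PS: "similar_rel (c_adj D D) (c_adj D D) (image_prod k X) {x\<^sub>0} (image_prod k Y) {y\<^sub>0}"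
    if "\<forall>i\<in>{1..k}. similar_rel (c_adj (n i) (n i)) (c_adj (n i) (n i)) (X i) {x i} (Y i) {y i}"
    using similar_rel_image_prod[of k X n Y "\<lambda>i. {x i}" "\<lambda>i. {y i}"] that X Y
    by (simp add: pointed assms(3))
  \<comment> \<open>This translation is valid only for base points in their images, so it is made
    under the bounded quantifier.\<close>
  have R: "(\<forall>i\<in>{1..k}. pointed_real_homotopy_equiv
        (c_adj (n i) (n i)) (c_adj (n i) (n i)) (X i) (x i) (Y i) (y i)) \<longleftrightarrow>
      (\<forall>i\<in>{1..k}. equiv_rel real_homotopic_rel
        (c_adj (n i) (n i)) (c_adj (n i) (n i)) (X i) {x i} (Y i) {y i})"
    using x y by (intro ball_cong pointed_real_homotopy_equiv_iff_rel) auto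
  show ?thesis
    unfolding R pointed_real_homotopy_equiv_iff_rel[OF x0]
      homotopy_equiv_iff_rel pointed_homotopy_equiv_iff_rel homotopically_similar_iff_rel
      pointed_homotopically_similar_iff_rel long_homotopy_equiv_iff_rel
      pointed_long_homotopy_equiv_iff_rel real_homotopy_equiv_iff_rel
    by (intro conjI impI E P ES PS multiplicative_homotopic_rel multiplicative_long_homotopic_rel
        multiplicative_real_homotopic_rel)
qed

end
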